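(* Let a discrete group $\Gamma$ act on a compact Hausdorff space $X$ (by homeomorphisms). For an orbit $\gamma=\Gamma x$ let $\overline{\gamma}$ be its closure in $X$. 1) If the action is Lyapunov stable, then for every orbit $\gamma$ there is a unique $\Gamma$-invariant regular Borel measure $\mu_{\overline{\gamma}}$ on $\overline{\gamma}$ of total mass $1$, and for every $\varphi\in C(X)$ and $x\in\gamma$ $$M(\varphi_x)=\int_{\overline{\gamma}}\varphi|_{\overline{\gamma}}\,d\mu_{\overline{\gamma}} .$$ 2) If $\gamma$ is finite, then for every $\varphi\in C(X)$ and $x\in\gamma$ the value $M(\varphi_x)$ is the standard average over the orbit, $M(\varphi_x)=\frac{1}{\#\gamma}\sum_{y\in\gamma}\varphi(y)$.
   Context: For $\varphi\in C(X)$ and $x\in X$, $\varphi_x:\Gamma\to\mathbb{C}$ is $\varphi_x(g)=\varphi(gx)$. The compact Hausdorff space $X$ carries its unique compatible uniform structure $\Phi$, consisting of all neighborhoods of the diagonal in $X\times X$. The action is Lyapunov stable if for every $\mathbb{U}\in\Phi$ and every $x\in X$ there is $\mathbb{V}\in\Phi$ such that, whenever $(x,y)\in\mathbb{V}$, one has $(gx,gy)\in\mathbb{U}$ for all $g\in\Gamma$. A bounded function $f:\Gamma\to\mathbb{C}$ is almost periodic if the set of its translates $\{h\mapsto f(hg) : g\in\Gamma\}$ is totally bounded in the uniform norm. $M$ denotes the unique invariant mean (positive, normalized, translation-invariant linear functional) on the space of almost periodic functions on $\Gamma$. For a Lyapunov stable action, every $\varphi_x$ with $\varphi\in C(X)$,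 $x\in X$, is almost periodic; the same holds if the orbit of $x$ is finite. *)

theory Defs
  imports "HOL-Analysis.Analysis" "HOL-Algebra.Group_Action"
begin

definition homeo_action ::
    "('g, 'm) monoid_scheme \<Rightarrow> 'x topology \<Rightarrow> ('g \<Rightarrow> 'x \<Rightarrow> 'x) \<Rightarrow> bool"
  where "homeo_action G X act \<longleftrightarrow>
    group_action G (topspace X) act \<and> (\<forall>g\<in>carrier G. homeomorphic_map X X (act g))"


text \<open>The compatible uniform structure of a compact Hausdorff space: all (not necessarily open)
  neighbourhoods of the diagonal.\<close>

definition entourages :: "'x topology \<Rightarrow> ('x \<times> 'x) set set"
  where "entourages X = {U. U \<subseteq> topspace X \<times> topspace X \<and>
    (\<exists>W. openin (prod_topology X X) W \<and> Id_on (topspace X) \<subseteq> W \<and> W \<subseteq> U)}"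

definition lyapunov_stable ::
    "('g, 'm) monoid_scheme \<Rightarrow> 'x topology \<Rightarrow> ('g \<Rightarrow> 'x \<Rightarrow> 'x) \<Rightarrow> bool"
  where "lyapunov_stable G X act \<longleftrightarrow>
    (\<forall>U\<in>entourages X. \<forall>x\<in>topspace X. \<exists>V\<in>entourages X.
       \<forall>y. (x, y) \<in> V \<longrightarrow> (\<forall>g\<in>carrier G. (act g x, act g y) \<in> U))"


text \<open>Functions on the group are represented by HOL functions that are extensional on the carrier;
  \<^term>\<open>funspace (carrier G) (euclidean_metric :: complex metric)\<close> is the library's space of the
  bounded ones, with the uniform metric.\<close>

definition translate ::
    "('g, 'm) monoid_scheme \<Rightarrow> 'g \<Rightarrow> ('g \<Rightarrow> complex) \<Rightarrow> 'g \<Rightarrow> complex"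
  where "translate G g f = (\<lambda>h\<in>carrier G. f (h \<otimes>\<^bsub>G\<^esub> g))"

definition almost_periodic :: "('g, 'm) monoid_scheme \<Rightarrow> ('g \<Rightarrow> complex) set"
  where "almost_periodic G =
    (let B = funspace (carrier G) (euclidean_metric :: complex metric) in
      {f \<in> mspace B.
        Metric_space.mtotally_bounded (mspace B) (mdist B) ((\<lambda>g. translate G g f) ` carrier G)})"

text \<open>Invariance is required under the translations occurring in the definition of almost
  periodicity. These already determine the mean, which is then invariant under
  translations on the other side as well. Extensionality of \<open>M\<close> makes it unique as a HOL function.\<close>

definition invariant_mean ::
    "('g, 'm) monoid_scheme \<Rightarrow> (('g \<Rightarrow> complex) \<Rightarrow> complex) \<Rightarrow> bool"
  where "invariant_mean G M \<longleftrightarrow>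
    M \<in> extensional (almost_periodic G) \<and>
    (\<forall>f\<in>almost_periodic G. \<forall>k\<in>almost_periodic G. \<forall>a b.
       M (\<lambda>h\<in>carrier G. a * f h + b * k h) = a * M f + b * M k) \<and>
    (\<forall>f\<in>almost_periodic G. (\<forall>h\<in>carrier G. f h \<in> \<real>\<^sub>\<ge>\<^sub>0) \<longrightarrow> M f \<in> \<real>\<^sub>\<ge>\<^sub>0) \<and>
    M (\<lambda>h\<in>carrier G. 1) = 1 \<and>
    (\<forall>f\<in>almost_periodic G. \<forall>g\<in>carrier G. M (translate G g f) = M f)"

definition ap_mean :: "('g, 'm) monoid_scheme \<Rightarrow> ('g \<Rightarrow> complex) \<Rightarrow> complex"
  where "ap_mean G = (THE M. invariant_mean G M)"

definition orbit_fun ::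
    "('g, 'm) monoid_scheme \<Rightarrow> ('g \<Rightarrow> 'x \<Rightarrow> 'x) \<Rightarrow> ('x \<Rightarrow> complex) \<Rightarrow> 'x \<Rightarrow> 'g \<Rightarrow> complex"
  where "orbit_fun G act \<phi> x = (\<lambda>g\<in>carrier G. \<phi> (act g x))"


definition regular_borel_measure :: "'x topology \<Rightarrow> 'x measure \<Rightarrow> bool"
  where "regular_borel_measure T \<mu> \<longleftrightarrow>
    space \<mu> = topspace T \<and>
    sets \<mu> = sigma_sets (topspace T) {U. openin T U} \<and>
    (\<forall>K. compactin T K \<longrightarrow> emeasure \<mu> K < \<infinity>) \<and>
    (\<forall>A\<in>sets \<mu>. emeasure \<mu> A = (INF U\<in>{U. openin T U \<and> A \<subseteq> U}. emeasure \<mu> U)) \<and>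
    (\<forall>A\<in>sets \<mu>. emeasure \<mu> A = (SUP K\<in>{K. compactin T K \<and> K \<subseteq> A}. emeasure \<mu> K))"

definition invariant_measure ::
    "('g, 'm) monoid_scheme \<Rightarrow> ('g \<Rightarrow> 'x \<Rightarrow> 'x) \<Rightarrow> 'x measure \<Rightarrow> bool"
  where "invariant_measure G act \<mu> \<longleftrightarrow>
    (\<forall>g\<in>carrier G. \<forall>A\<in>sets \<mu>. emeasure \<mu> (act g ` A) = emeasure \<mu> A)"

definition invariant_regular_prob ::
    "('g, 'm) monoid_scheme \<Rightarrow> ('g \<Rightarrow> 'x \<Rightarrow> 'x) \<Rightarrow> 'x topology \<Rightarrow> 'x measure \<Rightarrow> bool"
  where "invariant_regular_prob G act T \<mu> \<longleftrightarrow>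
    regular_borel_measure T \<mu> \<and> invariant_measure G act \<mu> \<and> emeasure \<mu> (topspace T) = 1"

end

theory Submission
  imports Defs
begin

text \<open>A function \<open>f\<close> on the group has mean \<open>c\<close> if finite averages \<open>1/n \<Sum> f (a p\<^sub>i b)\<close> are uniformly
  close to \<open>c\<close> in \<open>a\<close> and \<open>b\<close>. Almost periodic functions have such a mean, and any invariant mean must
  take this value. Lyapunov stability and compactness make the functions \<open>\<phi>\<^sub>x\<close> almost periodic. Their
  mean is a positive functional on the continuous functions on the orbit closure, so Riesz
  representation produces an invariant measure. Conversely, averages of \<open>\<phi>\<close> that are nearly constant on
  the orbit are nearly constant on its closure, and an invariant probability measure integrates them
  like \<open>\<phi>\<close>; hence its integrals are the means, which also determines the measure. On a finite orbit the
  same argument applies with summation over the orbit.\<close>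

section \<open>Riesz representation on compact Hausdorff spaces\<close>

text \<open>Almost periodicity and the invariance of \<open>M\<close> are stated for the translates
  h |-> f(hg), while invariance of the measure under g concerns h |-> phi(ghx), a translate on the
  other side. This is why averages have to be uniform in both factors. The left factor gives bounds
  valid on the whole group, to which positivity of an invariant mean applies, and it yields
  invariance of the measure. The right factor moves the base point along the orbit, since p b x = p
  y for y = b x. Together they make any two averaging lists compatible, and so the value unique. The
  Riesz measure serves existence alone. The integral formula is derived from invariance for every
  invariant regular probability measure and with values in a Banach space; this gives the complex
  formula and, for real functions, the agreement of any two such measures.\<close>

lemma Urysohn_bump:
  assumes "compact_space X" "Hausdorff_space X" "closedin X C" "openin X U" "C \<subseteq> U"
  obtains g where "continuous_map X euclideanreal g" "\<And>x. x \<in> topspace X \<Longrightarrow> 0 \<le> g x"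
    "\<And>x. x \<in> topspace X \<Longrightarrow> g x \<le> 1" "\<And>x. x \<in> topspace X \<Longrightarrow> x \<notin> U \<Longrightarrow> g x = 0"
    "\<And>x. x \<in> C \<Longrightarrow> g x = 1"
proof -
  have "normal_space X"
    using assms by (simp add: compact_Hausdorff_or_regular_imp_normal_space)
  moreover have "closedin X (topspace X - U)" "disjnt (topspace X - U) C"
    using assms by (auto simp: disjnt_def)
  ultimately obtain g where g: "continuous_map X (top_of_set {0..1::real}) g"
    "g ` (topspace X - U) \<subseteq> {0}" "g ` C \<subseteq> {1}"
    using Urysohn_lemma[of X _ C "0::real" 1] assms by (metis zero_le_one)
  show thesis
    by (rule that[of g]) (use g in \<open>auto simp: continuous_map_in_subtopology\<close>)
qed

lemma continuous_bounded:
  fixes f :: "'x \<Rightarrow> 'b :: real_normed_vector"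
  assumes "compact_space X" "continuous_map X euclidean f"
  obtains B where "B > 0" "\<And>x. x \<in> topspace X \<Longrightarrow> norm (f x) \<le> B"
proof -
  have "compactin euclidean (f ` topspace X)"
    using assms by (intro image_compactin) (simp_all add: compact_space_def)
  then have "bounded (f ` topspace X)"
    by (simp add: compact_imp_bounded)
  then show thesis
    using that unfolding bounded_pos by blast
qed

section \<open>Regular Borel measures on compact spaces\<close>

lemma regular_borelD:
  assumes "regular_borel_measure X \<mu>"
  shows "space \<mu> = topspace X" "sets \<mu> = sigma_sets (topspace X) {U. openin X U}"
    "openin X U \<Longrightarrow> U \<in> sets \<mu>" "closedin X C \<Longrightarrow> C \<in> sets \<mu>"
    "compactin X K \<Longrightarrow> emeasure \<mu> K < \<infinity>"
    "A \<in> sets \<mu> \<Longrightarrow> emeasure \<mu> A = (INF U\<in>{U. openin X U \<and> A \<subseteq> U}. emeasure \<mu> U)"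
    "A \<in> sets \<mu> \<Longrightarrow> emeasure \<mu> A = (SUP K\<in>{K. compactin X K \<and> K \<subseteq> A}. emeasure \<mu> K)"
proof -
  show space: "space \<mu> = topspace X" and sets: "sets \<mu> = sigma_sets (topspace X) {U. openin X U}"
    using assms unfolding regular_borel_measure_def by blast+
  show "compactin X K \<Longrightarrow> emeasure \<mu> K < \<infinity>"
    "A \<in> sets \<mu> \<Longrightarrow> emeasure \<mu> A = (INF U\<in>{U. openin X U \<and> A \<subseteq> U}. emeasure \<mu> U)"
    "A \<in> sets \<mu> \<Longrightarrow> emeasure \<mu> A = (SUP K\<in>{K. compactin X K \<and> K \<subseteq> A}. emeasure \<mu> K)"
    using assms unfolding regular_borel_measure_def by blast+
  show op: "openin X U \<Longrightarrow> U \<in> sets \<mu>" for U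
    unfolding sets by (simp add: sigma_sets.Basic)
  show "closedin X C \<Longrightarrow> C \<in> sets \<mu>"
    using sets.compl_sets[OF op, of "topspace X - C"] closedin_subset[of X C]
    by (simp add: space double_diff openin_diff)
qed

lemma regular_borel_finite:
  assumes "compact_space X" "regular_borel_measure X \<mu>"
  shows "finite_measure \<mu>"
  using regular_borelD(1,5)[OF assms(2)] assms(1)
  by (intro finite_measureI) (auto simp: compact_space_def less_top)

lemma regular_borel_measurable:
  fixes f :: "'x \<Rightarrow> 'b :: topological_space"
  assumes "regular_borel_measure X \<mu>" "continuous_map X euclidean f"
  shows "f \<in> borel_measurable \<mu>"
proof (rule borel_measurableI)
  fix S :: "'b set" assume "open S"
  then have "openin X {x \<in> topspace X. f x \<in> S}"
    using assms by (intro openin_continuous_map_preimage) auto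
  moreover have "{x \<in> topspace X. f x \<in> S} = f -` S \<inter> space \<mu>"
    using regular_borelD(1)[OF assms(1)] by auto
  ultimately show "f -` S \<inter> space \<mu> \<in> sets \<mu>"
    using regular_borelD(3)[OF assms(1)] by metis
qed

lemma regular_borel_integrable:
  fixes f :: "'x \<Rightarrow> 'b :: {banach, second_countable_topology}"
  assumes "compact_space X" "regular_borel_measure X \<mu>" "continuous_map X euclidean f"
  shows "integrable \<mu> f"
proof -
  obtain B where "B > 0" "\<And>x. x \<in> topspace X \<Longrightarrow> norm (f x) \<le> B"
    using continuous_bounded[OF assms(1,3)] by blast
  then show ?thesis
    using regular_borel_measurable[OF assms(2,3)] regular_borelD(1)[OF assms(2)]
    by (intro finite_measure.integrable_const_bound[OF regular_borel_finite[OF assms(1,2)], where B = B] AE_I2)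
      simp_all
qed

text \<open>Regularity reduces the comparison of two measures to compact sets inside open ones, which are
  separated by a continuous function.\<close>

lemma regular_borel_le_image:
  assumes X: "compact_space X" "Hausdorff_space X"
    and \<mu>: "regular_borel_measure X \<mu>" and \<nu>: "regular_borel_measure X \<nu>"
    and S: "continuous_map X X S"
    and int: "\<And>f. continuous_map X euclideanreal f \<Longrightarrow> (\<integral>x. f (S x) \<partial>\<mu>) = (\<integral>x. f x \<partial>\<nu>)"
    and A: "A \<in> sets \<mu>" "S ` A \<in> sets \<nu>"
  shows "emeasure \<mu> A \<le> emeasure \<nu> (S ` A)"
proof -
  interpret \<mu>: finite_measure \<mu> by (rule regular_borel_finite[OF X(1) \<mu>])
  interpret \<nu>: finite_measure \<nu> by (rule regular_borel_finite[OF X(1) \<nu>])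
  have "emeasure \<mu> C \<le> emeasure \<nu> (S ` A)" if C: "compactin X C" "C \<subseteq> A" for C
  proof -
    have Cc: "closedin X C" and SC: "closedin X (S ` C)"
      using C(1) S X(2) by (auto intro!: compactin_imp_closedin image_compactin)
    have CX: "C \<subseteq> topspace X" using closedin_subset[OF Cc] .
    have "emeasure \<mu> C \<le> emeasure \<nu> U" if U: "openin X U" "S ` C \<subseteq> U" for U
    proof -
      \<comment> \<open>\<open>f\<close> composed with \<open>S\<close> dominates the indicator of
        \<open>C\<close>, and \<open>f\<close> is dominated by the indicator of \<open>U\<close>;
        \<open>int\<close> links the two integrals.\<close>
      obtain f where f: "continuous_map X euclideanreal f" "\<And>x. x \<in> topspace X \<Longrightarrow> 0 \<le> f x"
        "\<And>x. x \<in> topspace X \<Longrightarrow> f x \<le> 1" "\<And>x. x \<in> topspace X \<Longrightarrow> x \<notin> U \<Longrightarrow> f x = 0"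
        "\<And>x. x \<in> S ` C \<Longrightarrow> f x = 1"
        using Urysohn_bump[OF X SC U] by metis
      have fS: "continuous_map X euclideanreal (\<lambda>x. f (S x))"
        using continuous_map_compose[OF S f(1)] by (simp add: o_def)
      have SX: "S x \<in> topspace X" if "x \<in> topspace X" for x
        using S that by (auto simp: continuous_map_def)
      have "measure \<mu> C = (\<integral>x. indicator C x \<partial>\<mu>)"
        using CX by (simp add: regular_borelD(1)[OF \<mu>] Int_absorb2)
      also have "\<dots> \<le> (\<integral>x. f (S x) \<partial>\<mu>)"
      proof (rule integral_mono)
        show "integrable \<mu> (indicator C :: 'a \<Rightarrow> real)"
          using regular_borelD(4)[OF \<mu> Cc] by (simp add: less_top[symmetric])
        show "integrable \<mu> (\<lambda>x. f (S x))"
          by (rule regular_borel_integrable[OF X(1) \<mu> fS])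
        show "indicator C x \<le> f (S x)" if "x \<in> space \<mu>" for x
          using that f(2,5) SX by (auto simp: indicator_def regular_borelD(1)[OF \<mu>])
      qed
      also have "\<dots> = (\<integral>x. f x \<partial>\<nu>)"
        by (rule int[OF f(1)])
      also have "\<dots> \<le> (\<integral>x. indicator U x \<partial>\<nu>)"
      proof (rule integral_mono)
        show "integrable \<nu> (indicator U :: 'a \<Rightarrow> real)"
          using regular_borelD(3)[OF \<nu> U(1)] by (simp add: less_top[symmetric])
        show "integrable \<nu> f"
          by (rule regular_borel_integrable[OF X(1) \<nu> f(1)])
        show "f x \<le> indicator U x" if "x \<in> space \<nu>" for x
          using that f(3,4) by (auto simp: indicator_def regular_borelD(1)[OF \<nu>])
      qed
      also have "\<dots> = measure \<nu> U"
        using openin_subset[OF U(1)] by (simp add: regular_borelD(1)[OF \<nu>] Int_absorb2)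
      finally show ?thesis
        by (simp add: \<mu>.emeasure_eq_measure \<nu>.emeasure_eq_measure ennreal_leI)
    qed
    then have "emeasure \<mu> C \<le> emeasure \<nu> (S ` C)"
      unfolding regular_borelD(6)[OF \<nu> regular_borelD(4)[OF \<nu> SC]] by (intro INF_greatest) auto
    also have "\<dots> \<le> emeasure \<nu> (S ` A)"
      using C(2) A(2) by (intro emeasure_mono) auto
    finally show ?thesis .
  qed
  then show ?thesis
    unfolding regular_borelD(7)[OF \<mu> A(1)] by (intro SUP_least) auto
qed

section \<open>The outer measure of a positive normalized functional\<close>

locale compact_mean =
  fixes X :: "'x topology" and L :: "('x \<Rightarrow> real) \<Rightarrow> real"
  assumes compact: "compact_space X" and Hausdorff: "Hausdorff_space X"
    and L_add: "\<And>f g. continuous_map X euclideanreal f \<Longrightarrow> continuous_map X euclideanreal g \<Longrightarrow>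
      L (\<lambda>x. f x + g x) = L f + L g"
    and L_scale: "\<And>f c. continuous_map X euclideanreal f \<Longrightarrow> L (\<lambda>x. c * f x) = c * L f"
    and L_nonneg: "\<And>f. continuous_map X euclideanreal f \<Longrightarrow> (\<And>x. x \<in> topspace X \<Longrightarrow> 0 \<le> f x) \<Longrightarrow> 0 \<le> L f"
    and L_one: "L (\<lambda>_. 1) = 1"
begin

text \<open>Bump functions need not have support inside \<open>U\<close>; where this matters, \<open>f\<close> is replaced by
  \<open>max (f - e) 0\<close>, which changes the functional by at most \<open>e\<close>.\<close>

definition bumps :: "'x set \<Rightarrow> ('x \<Rightarrow> real) set"
  where "bumps U = {f. continuous_map X euclideanreal f \<and> (\<forall>x\<in>topspace X. 0 \<le> f x \<and> f x \<le> 1) \<and>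
    (\<forall>x\<in>topspace X - U. f x = 0)}"

text \<open>The Riesz formula for the mass of an open set, in \<open>ennreal\<close> so that suprema
  and countable sums always exist.\<close>

definition open_mass :: "'x set \<Rightarrow> ennreal"
  where "open_mass U = (SUP f\<in>bumps U. ennreal (L f))"

text \<open>Taking the infimum over open supersets builds outer regularity into the measure from the
  start.\<close>

definition outer :: "'x set \<Rightarrow> ennreal"
  where "outer A = (INF U\<in>{U. openin X U \<and> A \<subseteq> U}. open_mass U)"

lemma bumpsI:
  assumes "continuous_map X euclideanreal f" "\<And>x. x \<in> topspace X \<Longrightarrow> 0 \<le> f x"
    "\<And>x. x \<in> topspace X \<Longrightarrow> f x \<le> 1" "\<And>x. x \<in> topspace X \<Longrightarrow> x \<notin> U \<Longrightarrow> f x = 0"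
  shows "f \<in> bumps U"
  using assms by (auto simp: bumps_def)

lemma bumpsD:
  assumes "f \<in> bumps U"
  shows "continuous_map X euclideanreal f" "\<And>x. x \<in> topspace X \<Longrightarrow> 0 \<le> f x"
    "\<And>x. x \<in> topspace X \<Longrightarrow> f x \<le> 1" "\<And>x. x \<in> topspace X \<Longrightarrow> x \<notin> U \<Longrightarrow> f x = 0"
  using assms by (auto simp: bumps_def)

lemma L_diff:
  assumes "continuous_map X euclideanreal f" "continuous_map X euclideanreal g"
  shows "L (\<lambda>x. f x - g x) = L f - L g"
  using L_add[OF assms(1), of "\<lambda>x. (-1) * g x"] L_scale[OF assms(2), of "-1"] assms
  by simp

text \<open>Positivity of the difference. Used in both directions it shows that \<open>L\<close>
  cannot see values off \<open>topspace X\<close>, because \<open>L_nonneg\<close> tests points of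
  the space only.\<close>

lemma L_mono:
  assumes "continuous_map X euclideanreal f" "continuous_map X euclideanreal g"
    "\<And>x. x \<in> topspace X \<Longrightarrow> f x \<le> g x"
  shows "L f \<le> L g"
  using L_nonneg[of "\<lambda>x. g x - f x"] L_diff[OF assms(2,1)] assms
  by (auto intro: continuous_intros)

lemma L_const: "L (\<lambda>_. c) = c"
  using L_scale[of "\<lambda>_. 1" c] L_one by simp

lemma L_sum:
  assumes "finite I" "\<And>i. i \<in> I \<Longrightarrow> continuous_map X euclideanreal (f i)"
  shows "L (\<lambda>x. \<Sum>i\<in>I. f i x) = (\<Sum>i\<in>I. L (f i))"
  using assms
proof (induction I)
  case empty
  then show ?case using L_const[of 0] by simp
next
  case (insert i I)
  then show ?case
    by (simp add: L_add continuous_map_sum)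
qed

lemma L_le_cut:
  assumes "continuous_map X euclideanreal f"
  shows "L f \<le> L (\<lambda>x. max (f x - e) 0) + e"
proof -
  have "L f \<le> L (\<lambda>x. max (f x - e) 0 + e)"
    using assms by (intro L_mono continuous_intros) auto
  also have "\<dots> = L (\<lambda>x. max (f x - e) 0) + e"
    using assms by (subst L_add) (auto simp: L_const intro!: continuous_intros)
  finally show ?thesis .
qed

lemma bump_exists:
  assumes "closedin X C" "openin X U" "C \<subseteq> U"
  obtains g where "g \<in> bumps U" "\<And>x. x \<in> C \<Longrightarrow> g x = 1"
  by (rule Urysohn_bump[OF compact Hausdorff assms]) (rule that[OF bumpsI])

lemma bumps_L_le_1: "f \<in> bumps U \<Longrightarrow> L f \<le> 1"
  using L_mono[of f "\<lambda>_. 1"] by (auto simp: bumps_def L_const)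

lemma bumps_L_nonneg: "f \<in> bumps U \<Longrightarrow> 0 \<le> L f"
  using L_nonneg[of f] by (auto simp: bumps_def)

lemma zero_bump: "(\<lambda>_. 0) \<in> bumps U"
  by (auto simp: bumps_def)

lemma bump_le_open_mass: "f \<in> bumps U \<Longrightarrow> ennreal (L f) \<le> open_mass U"
  by (auto simp: open_mass_def intro: SUP_upper)

lemma open_mass_mono: "U \<subseteq> V \<Longrightarrow> open_mass U \<le> open_mass V"
  unfolding open_mass_def by (rule SUP_subset_mono) (auto simp: bumps_def)

lemma open_mass_space: "open_mass (topspace X) = 1"
proof (rule antisym)
  show "open_mass (topspace X) \<le> 1"
    unfolding open_mass_def using bumps_L_le_1 by (intro SUP_least) (auto simp: ennreal_le_1)
  show "1 \<le> open_mass (topspace X)"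
    using bump_le_open_mass[of "\<lambda>_. 1" "topspace X"] by (simp add: bumps_def L_one)
qed

lemma open_mass_empty: "open_mass {} = 0"
proof -
  have "L f = 0" if "f \<in> bumps {}" for f
    using L_mono[of f "\<lambda>_. 0"] bumps_L_nonneg[OF that] bumpsD[OF that] by (simp add: L_const)
  then show ?thesis
    unfolding open_mass_def using zero_bump by (intro antisym SUP_least) auto
qed

text \<open>A bump \<open>f\<close> on the union is split as f g + f (1 - g). Here \<open>g\<close>
  is a bump on \<open>U\<close> equal to 1 on the closed set \<open>C\<close> where \<open>f\<close>
  is at least \<open>e\<close> outside \<open>V\<close>; \<open>C\<close> lies in \<open>U\<close>
  because \<open>f\<close> vanishes off the union. Off \<open>V\<close> the second summand is then
  at most \<open>e\<close>, so cutting it at \<open>e\<close> makes it a bump on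
  \<open>V\<close>.\<close>

lemma open_mass_Un:
  assumes U: "openin X U" and V: "openin X V"
  shows "open_mass (U \<union> V) \<le> open_mass U + open_mass V"
  unfolding open_mass_def[of "U \<union> V"]
proof (rule SUP_least)
  fix f assume f: "f \<in> bumps (U \<union> V)"
  note fD = bumpsD[OF f]
  show "ennreal (L f) \<le> open_mass U + open_mass V"
  proof (rule ennreal_le_epsilon)
    fix e :: real assume e: "e > 0"
    define C where "C = {x \<in> topspace X. f x \<in> {e..}} - V"
    have "closedin X C"
      unfolding C_def using fD(1) V
      by (intro closedin_diff closedin_continuous_map_preimage) auto
    moreover have "C \<subseteq> U"
      using fD(4) e by (force simp: C_def)
    ultimately obtain g where g: "g \<in> bumps U" "\<And>x. x \<in> C \<Longrightarrow> g x = 1"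
      using bump_exists U by blast
    note gD = bumpsD[OF g(1)]
    let ?f1 = "\<lambda>x. f x * g x" and ?f2 = "\<lambda>x. max (f x * (1 - g x) - e) 0"
    have 1: "?f1 \<in> bumps U"
      using fD gD by (intro bumpsI) (auto intro!: continuous_intros mult_le_one)
    have 2: "?f2 \<in> bumps V"
    proof (rule bumpsI)
      show "continuous_map X euclideanreal ?f2"
        using fD gD by (intro continuous_intros) auto
      fix x assume x: "x \<in> topspace X"
      show "0 \<le> ?f2 x" by simp
      have "f x * (1 - g x) \<le> f x * 1"
        using fD gD x by (intro mult_left_mono) auto
      then have *: "f x * (1 - g x) \<le> f x" by simp
      then show "?f2 x \<le> 1"
        using fD(3)[OF x] e by auto
      show "?f2 x = 0" if "x \<notin> V"
      proof (cases "x \<in> C")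
        case True
        then show ?thesis using g(2) e by simp
      next
        case False
        then show ?thesis using * that x by (auto simp: C_def)
      qed
    qed
    have "L f \<le> L (\<lambda>x. ?f1 x + (?f2 x + e))"
      using fD gD by (intro L_mono continuous_intros) (auto simp: algebra_simps max_def)
    also have "\<dots> = L ?f1 + (L ?f2 + e)"
      using bumpsD(1)[OF 1] bumpsD(1)[OF 2]
      by (simp add: L_add L_const continuous_map_add)
    finally have "ennreal (L f) \<le> ennreal (L ?f1) + ennreal (L ?f2) + ennreal e"
      using bumps_L_nonneg[OF 1] bumps_L_nonneg[OF 2] e
      by (simp flip: ennreal_plus add: ennreal_leI)
    also have "\<dots> \<le> open_mass U + open_mass V + e"
      using bump_le_open_mass[OF 1] bump_le_open_mass[OF 2] by (intro add_mono) auto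
    finally show "ennreal (L f) \<le> open_mass U + open_mass V + e" .
  qed
qed

lemma open_mass_finite_UN:
  assumes "\<And>i::nat. openin X (U i)"
  shows "open_mass (\<Union>i<n. U i) \<le> (\<Sum>i<n. open_mass (U i))"
proof (induction n)
  case (Suc n)
  have "open_mass (\<Union>i<Suc n. U i) = open_mass ((\<Union>i<n. U i) \<union> U n)"
    by (simp add: lessThan_Suc Un_commute)
  also have "\<dots> \<le> open_mass (\<Union>i<n. U i) + open_mass (U n)"
    using assms by (intro open_mass_Un) auto
  finally show ?case
    using Suc by (simp add: order_trans add_right_mono)
qed (simp add: open_mass_empty)

text \<open>Compactness turns finite into countable subadditivity: the set where \<open>f\<close> is
  at least \<open>e\<close> is compact, so finitely many \<open>U i\<close> cover it, and
  \<open>f\<close> cut at \<open>e\<close> is a bump on their union.\<close>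

lemma open_mass_UN:
  assumes "\<And>i::nat. openin X (U i)"
  shows "open_mass (\<Union>i. U i) \<le> (\<Sum>i. open_mass (U i))"
  unfolding open_mass_def[of "\<Union>i. U i"]
proof (rule SUP_least)
  fix f assume f: "f \<in> bumps (\<Union>i. U i)"
  note fD = bumpsD[OF f]
  show "ennreal (L f) \<le> (\<Sum>i. open_mass (U i))"
  proof (rule ennreal_le_epsilon)
    fix e :: real assume e: "e > 0"
    define C where "C = {x \<in> topspace X. f x \<in> {e..}}"
    have "closedin X C"
      unfolding C_def using fD(1) by (intro closedin_continuous_map_preimage) auto
    then have "compactin X C"
      using compact closedin_compact_space by blast
    moreover have "C \<subseteq> \<Union>(range U)"
      using fD(4) e by (force simp: C_def)
    ultimately obtain F where F: "finite F" "F \<subseteq> range U" "C \<subseteq> \<Union>F"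
      using compactinD[of X C "range U"] assms by auto
    obtain J where J: "finite J" "F = U ` J"
      using F(1,2) finite_subset_image[of F U UNIV] by auto
    obtain n where n: "J \<subseteq> {..<n}"
      using J(1) finite_nat_bounded by blast
    let ?g = "\<lambda>x. max (f x - e) 0"
    have g: "?g \<in> bumps (\<Union>i<n. U i)"
    proof (rule bumpsI)
      show "continuous_map X euclideanreal ?g"
        using fD by (intro continuous_intros) auto
      fix x assume x: "x \<in> topspace X"
      show "0 \<le> ?g x" "?g x \<le> 1" using fD(3)[OF x] e by auto
      show "?g x = 0" if "x \<notin> (\<Union>i<n. U i)"
      proof -
        have "x \<notin> C" using F(3) J n that by blast
        then show ?thesis using x by (auto simp: C_def)
      qed
    qed
    have "ennreal (L f) \<le> ennreal (L ?g) + ennreal e"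
      using L_le_cut[OF fD(1)] bumps_L_nonneg[OF g] e
      by (simp flip: ennreal_plus add: ennreal_leI)
    also have "\<dots> \<le> (\<Sum>i<n. open_mass (U i)) + e"
      using order_trans[OF bump_le_open_mass[OF g] open_mass_finite_UN] assms by (intro add_mono) auto
    also have "\<dots> \<le> (\<Sum>i. open_mass (U i)) + e"
      by (intro add_right_mono sum_le_suminf) auto
    finally show "ennreal (L f) \<le> (\<Sum>i. open_mass (U i)) + e" .
  qed
qed

lemma outer_open: "openin X U \<Longrightarrow> outer U = open_mass U"
  unfolding outer_def
  by (intro antisym INF_lower INF_greatest) (auto intro: open_mass_mono)

lemma outer_mono: "A \<subseteq> B \<Longrightarrow> outer A \<le> outer B"
  unfolding outer_def by (rule INF_superset_mono) auto

lemma outer_close: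
  assumes "outer A < t"
  obtains U where "openin X U" "A \<subseteq> U" "open_mass U < t"
  using assms unfolding outer_def by (auto simp: INF_less_iff)

lemma outer_UN: "outer (\<Union>i::nat. A i) \<le> (\<Sum>i. outer (A i))"
proof (rule ennreal_le_epsilon)
  fix e :: real assume e: "0 < e" and fin: "(\<Sum>n. outer (A n)) < top_class.top"
  \<comment> \<open>The weights \<open>(1/2)^Suc n\<close> sum to 1, so the total error is
    \<open>e\<close>. Finiteness of the series makes every \<open>outer (A n)\<close> finite, hence
    the inequality strict.\<close>
  then have *: "outer (A n) < outer (A n) + ennreal (e * (1/2)^Suc n)" for n
    by (auto simp add: less_top dest!: ennreal_suminf_lessD)
  have "\<exists>U. openin X U \<and> A n \<subseteq> U \<and> open_mass U \<le> outer (A n) + ennreal (e * (1/2)^Suc n)" for n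
    using outer_close[OF *[of n]] by (metis less_imp_le)
  then obtain U where U: "\<And>n. openin X (U n)" "\<And>n. A n \<subseteq> U n"
    "\<And>n. open_mass (U n) \<le> outer (A n) + ennreal (e * (1/2)^Suc n)"
    by metis
  have "outer (\<Union>i. A i) \<le> outer (\<Union>i. U i)"
    using U(2) by (intro outer_mono) blast
  also have "\<dots> \<le> (\<Sum>i. open_mass (U i))"
    using U(1) open_mass_UN[OF U(1)] by (subst outer_open) auto
  also have "\<dots> \<le> (\<Sum>n. outer (A n) + ennreal (e * (1/2) ^ Suc n))"
    by (intro suminf_le U) auto
  also have "\<dots> = (\<Sum>n. outer (A n)) + (\<Sum>n. ennreal e * ennreal ((1/2) ^ Suc n))"
    using e by (subst suminf_add[symmetric])
      (auto simp del: ennreal_suminf_cmult simp add: ennreal_mult[symmetric])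
  also have "\<dots> = (\<Sum>n. outer (A n)) + e"
    unfolding ennreal_suminf_cmult
    by (subst suminf_ennreal_eq[OF zero_le_power power_half_series]) auto
  finally show "outer (\<Union>i. A i) \<le> (\<Sum>n. outer (A n)) + e" .
qed

lemma outer_empty: "outer {} = 0"
  by (simp add: outer_open open_mass_empty)

lemma outer_Un: "outer (A \<union> B) \<le> outer A + outer B"
  using outer_UN[of "binaryset A B"]
  by (simp add: UN_binaryset_eq suminf_binaryset_eq outer_empty)

text \<open>Caratheodory's criterion for an open test set. A bump on \<open>V \<inter> U\<close> cut
  at height \<open>e\<close> and a bump on the part of \<open>V\<close> where the first is below
  \<open>e\<close> are never positive at the same point, so their sum is again a bump on
  \<open>V\<close>.\<close>

lemma open_mass_split:
  assumes U: "openin X U" and V: "openin X V"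
  shows "open_mass (V \<inter> U) + outer (V - U) \<le> open_mass V"
proof -
  have le: "ennreal (L f) + outer (V - U) \<le> open_mass V" if f: "f \<in> bumps (V \<inter> U)" for f
  proof (rule ennreal_le_epsilon)
    fix e :: real assume e: "e > 0"
    note fD = bumpsD[OF f]
    \<comment> \<open>\<open>W\<close> is open, contains \<open>V - U\<close> because
      \<open>f\<close> vanishes there, and the cut of \<open>f\<close> at \<open>e\<close> is zero
      on it. Its mass can therefore stand in for \<open>outer (V - U)\<close>.\<close>
    define W where "W = V - {x \<in> topspace X. f x \<in> {e..}}"
    have W: "openin X W"
      unfolding W_def using fD(1) V
      by (intro openin_diff closedin_continuous_map_preimage) auto
    let ?f = "\<lambda>x. max (f x - e) 0"
    have f0: "?f \<in> bumps V"
    proof (rule bumpsI)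
      show "continuous_map X euclideanreal ?f"
        using fD by (intro continuous_intros) auto
      fix x assume x: "x \<in> topspace X"
      show "0 \<le> ?f x" "?f x \<le> 1" using fD(3)[OF x] e by auto
      show "?f x = 0" if "x \<notin> V" using fD(4)[OF x] that e by auto
    qed
    have "outer (V - U) \<le> open_mass W"
      using fD(4) e V openin_subset[OF V] unfolding outer_open[OF W, symmetric]
      by (intro outer_mono) (force simp: W_def)
    moreover have "ennreal (L ?f) + open_mass W \<le> open_mass V"
    proof -
      have "ennreal (L ?f) + ennreal (L g) \<le> open_mass V" if g: "g \<in> bumps W" for g
      proof -
        note gD = bumpsD[OF g]
        have "(\<lambda>x. ?f x + g x) \<in> bumps V"
        proof (rule bumpsI)
          show "continuous_map X euclideanreal (\<lambda>x. ?f x + g x)"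
            using fD gD by (intro continuous_intros) auto
          fix x assume x: "x \<in> topspace X"
          show "0 \<le> ?f x + g x" using gD(2)[OF x] by simp
          show "?f x + g x \<le> 1"
          proof (cases "x \<in> W")
            case True
            then show ?thesis using gD(3)[OF x] x by (auto simp: W_def)
          next
            case False
            then show ?thesis using gD(4)[OF x] fD(3)[OF x] e by auto
          qed
          show "?f x + g x = 0" if "x \<notin> V"
            using that gD(4)[OF x] fD(4)[OF x] e by (auto simp: W_def)
        qed
        then have "ennreal (L (\<lambda>x. ?f x + g x)) \<le> open_mass V"
          by (rule bump_le_open_mass)
        then show ?thesis
          using bumpsD(1)[OF f0] gD(1) bumps_L_nonneg[OF f0] bumps_L_nonneg[OF g]
          by (simp add: L_add flip: ennreal_plus)
      qed
      \<comment> \<open>The zero bump makes the index set nonempty, which is required for moving a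
        constant across a supremum.\<close>
      moreover have "ennreal (L ?f) + (SUP g\<in>bumps W. ennreal (L g)) =
          (SUP g\<in>bumps W. ennreal (L ?f) + ennreal (L g))"
        using zero_bump by (intro ennreal_SUP_add_right) auto
      ultimately show ?thesis
        unfolding open_mass_def[of W] by (simp add: SUP_least)
    qed
    ultimately have *: "ennreal (L ?f) + outer (V - U) \<le> open_mass V"
      by (rule order_trans[OF add_left_mono])
    have "ennreal (L f) \<le> ennreal (L ?f) + ennreal e"
      using L_le_cut[OF fD(1)] bumps_L_nonneg[OF f0] e
      by (simp flip: ennreal_plus add: ennreal_leI)
    then have "ennreal (L f) + outer (V - U) \<le> ennreal (L ?f) + outer (V - U) + ennreal e"
      using add_right_mono by (fastforce simp: ac_simps)
    also have "\<dots> \<le> open_mass V + ennreal e"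
      by (rule add_right_mono[OF *])
    finally show "ennreal (L f) + outer (V - U) \<le> open_mass V + ennreal e" .
  qed
  have "(SUP f\<in>bumps (V \<inter> U). ennreal (L f)) + outer (V - U) =
      (SUP f\<in>bumps (V \<inter> U). ennreal (L f) + outer (V - U))"
    using zero_bump by (intro ennreal_SUP_add_left[symmetric]) auto
  also have "\<dots> \<le> open_mass V"
    by (intro SUP_least le)
  finally show ?thesis
    unfolding open_mass_def[of "V \<inter> U"] .
qed

text \<open>An arbitrary test set is replaced by an open superset, where
  \<open>open_mass_split\<close> applies; the infimum over such supersets gives the nontrivial
  inequality.\<close>

lemma open_lambda_system:
  assumes U: "openin X U"
  shows "U \<in> lambda_system (topspace X) (Pow (topspace X)) outer"
proof -
  have "outer (A \<inter> U) + outer (A - U) = outer A" if "A \<subseteq> topspace X" for A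
  proof (rule antisym)
    show "outer A \<le> outer (A \<inter> U) + outer (A - U)"
      using outer_Un[of "A \<inter> U" "A - U"] by (simp add: Int_Diff_Un)
    show "outer (A \<inter> U) + outer (A - U) \<le> outer A"
      unfolding outer_def[of A]
    proof (rule INF_greatest)
      fix V assume "V \<in> {U. openin X U \<and> A \<subseteq> U}"
      then have V: "openin X V" "A \<subseteq> V" by auto
      have "outer (A \<inter> U) + outer (A - U) \<le> outer (V \<inter> U) + outer (V - U)"
        using V by (intro add_mono outer_mono) auto
      also have "\<dots> \<le> open_mass V"
        using open_mass_split[OF U V(1)] outer_open[OF openin_Int[OF V(1) U]] by simp
      finally show "outer (A \<inter> U) + outer (A - U) \<le> open_mass V" .
    qed
  qed
  then show ?thesis
    using openin_subset[OF U] by (simp add: algebra.lambda_system_eq[OF algebra_Pow])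
qed

section \<open>The Riesz measure and its regularity\<close>

definition riesz_measure :: "'x measure"
  where "riesz_measure = measure_of (topspace X) {U. openin X U} outer"

lemma opens_subset: "{U. openin X U} \<subseteq> Pow (topspace X)"
  using openin_subset by auto

lemma space_riesz [simp]: "space riesz_measure = topspace X"
  by (simp add: riesz_measure_def opens_subset space_measure_of)

lemma sets_riesz: "sets riesz_measure = sigma_sets (topspace X) {U. openin X U}"
  by (simp add: riesz_measure_def opens_subset sets_measure_of)

text \<open>\<open>measure_of\<close> falls back to the zero measure unless the given function is a
  measure on the generated sigma-algebra. Caratheodory's theorem makes \<open>outer\<close> a
  measure on its measurable sets; these include the open sets, hence the whole Borel
  sigma-algebra.\<close>

lemma emeasure_riesz:
  assumes "A \<in> sets riesz_measure"
  shows "emeasure riesz_measure A = outer A"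
proof -
  let ?S = "lambda_system (topspace X) (Pow (topspace X)) outer"
  have "outer_measure_space (Pow (topspace X)) outer"
    using outer_UN unfolding outer_measure_space_def positive_def increasing_def countably_subadditive_def
    by (auto intro: outer_mono simp: outer_empty)
  then have ms: "measure_space (topspace X) ?S outer"
    by (rule sigma_algebra.caratheodory_lemma[OF sigma_algebra_Pow])
  then interpret S: sigma_algebra "topspace X" ?S
    by (simp add: measure_space_def)
  have sub: "sigma_sets (topspace X) {U. openin X U} \<subseteq> ?S"
    using open_lambda_system by (intro S.sigma_sets_subset) auto
  have "positive (sigma_sets (topspace X) {U. openin X U}) outer"
    by (simp add: positive_def outer_empty)
  moreover have "countably_additive (sigma_sets (topspace X) {U. openin X U}) outer"
    using ms sub unfolding measure_space_def countably_additive_def by (meson subset_iff)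
  ultimately show ?thesis
    using assms opens_subset
    by (intro emeasure_measure_of[OF riesz_measure_def]) (auto simp: sets_riesz)
qed


lemma open_in_sets: "openin X U \<Longrightarrow> U \<in> sets riesz_measure"
  by (simp add: sets_riesz sigma_sets.Basic)

lemma emeasure_riesz_open: "openin X U \<Longrightarrow> emeasure riesz_measure U = open_mass U"
  by (simp add: emeasure_riesz open_in_sets outer_open)

lemma emeasure_riesz_space: "emeasure riesz_measure (topspace X) = 1"
  by (simp add: emeasure_riesz_open open_mass_space)

lemma finite_riesz: "finite_measure riesz_measure"
  by (rule finite_measureI) (simp add: emeasure_riesz_space)

lemma outer_regular:
  assumes "A \<in> sets riesz_measure"
  shows "emeasure riesz_measure A = (INF U\<in>{U. openin X U \<and> A \<subseteq> U}. emeasure riesz_measure U)"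
  using assms by (simp add: emeasure_riesz outer_def emeasure_riesz_open cong: INF_cong_simp)

text \<open>Outer regularity of the complement: the complement of an open set is compact, and since
  the total mass is finite, errors survive complementation unchanged.\<close>

lemma inner_regular:
  assumes A: "A \<in> sets riesz_measure"
  shows "emeasure riesz_measure A = (SUP K\<in>{K. compactin X K \<and> K \<subseteq> A}. emeasure riesz_measure K)"
proof (rule antisym)
  interpret finite_measure riesz_measure by (rule finite_riesz)
  have B: "topspace X - A \<in> sets riesz_measure"
    using sets.compl_sets[OF A] by simp
  show "(SUP K\<in>{K. compactin X K \<and> K \<subseteq> A}. emeasure riesz_measure K) \<le> emeasure riesz_measure A"
    using A by (intro SUP_least emeasure_mono) auto
  show "emeasure riesz_measure A \<le> (SUP K\<in>{K. compactin X K \<and> K \<subseteq> A}. emeasure riesz_measure K)"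
  proof (rule ennreal_le_epsilon)
    fix e :: real assume "e > 0"
    then have "emeasure riesz_measure (topspace X - A) < emeasure riesz_measure (topspace X - A) + ennreal e"
      by (simp add: emeasure_eq_measure ennreal_less_iff flip: ennreal_plus)
    then obtain U where U: "openin X U" "topspace X - A \<subseteq> U"
      "emeasure riesz_measure U < emeasure riesz_measure (topspace X - A) + ennreal e"
      unfolding outer_regular[OF B] INF_less_iff by auto
    have Us: "U \<in> sets riesz_measure" using open_in_sets[OF U(1)] .
    let ?K = "topspace X - U"
    have K: "compactin X ?K" "?K \<subseteq> A"
      using compact U by (auto intro!: closedin_compact_space)
    have "measure riesz_measure U < measure riesz_measure (topspace X - A) + e"
      using U(3) \<open>e > 0\<close> by (simp add: emeasure_eq_measure ennreal_less_iff flip: ennreal_plus)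
    moreover have "measure riesz_measure (topspace X - A) = measure riesz_measure (topspace X) - measure riesz_measure A"
      "measure riesz_measure ?K = measure riesz_measure (topspace X) - measure riesz_measure U"
      using finite_measure_compl[OF A] finite_measure_compl[OF Us] by simp_all
    ultimately have "ennreal (measure riesz_measure A) \<le> ennreal (measure riesz_measure ?K + e)"
      by (intro ennreal_leI) linarith
    then have "emeasure riesz_measure A \<le> emeasure riesz_measure ?K + ennreal e"
      using \<open>e > 0\<close> by (simp only: emeasure_eq_measure ennreal_plus measure_nonneg less_imp_le)
    also have "\<dots> \<le> (SUP K\<in>{K. compactin X K \<and> K \<subseteq> A}. emeasure riesz_measure K) + ennreal e"
      using K by (intro add_right_mono SUP_upper) auto
    finally show "emeasure riesz_measure A \<le> (SUP K\<in>{K. compactin X K \<and> K \<subseteq> A}. emeasure riesz_measure K) + ennreal e" .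
  qed
qed

lemma regular_riesz: "regular_borel_measure X riesz_measure"
  unfolding regular_borel_measure_def
proof (intro conjI ballI allI impI)
  show "emeasure riesz_measure K < \<infinity>" for K
    using finite_measure.emeasure_finite[OF finite_riesz] by (simp add: less_top)
  show "space riesz_measure = topspace X"
    by (rule space_riesz)
  show "sets riesz_measure = sigma_sets (topspace X) {U. openin X U}"
    by (rule sets_riesz)
qed (erule outer_regular inner_regular)+

text \<open>Layer cake for a single value: the summand for k is the part of \<open>t\<close> between
  the heights k d and (k+1) d.\<close>

lemma sum_slices:
  assumes "0 \<le> (t::real)" "0 \<le> d"
  shows "(\<Sum>k<n. min (max (t - real k * d) 0) d) = min t (real n * d)"
  using assms by (induction n) (auto simp: algebra_simps min_def max_def)

text \<open>Cut \<open>f\<close> into layers of thickness \<open>d\<close>. A layer divided by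
  \<open>d\<close> is a bump on the level set \<open>U k\<close>, so \<open>L\<close> of the layer
  is at most \<open>d\<close> times the mass of \<open>U k\<close>. The resulting step function
  exceeds \<open>f\<close> by at most one layer.\<close>

lemma L_le_integral:
  assumes f: "continuous_map X euclideanreal f" "\<And>x. x \<in> topspace X \<Longrightarrow> 0 \<le> f x"
    "\<And>x. x \<in> topspace X \<Longrightarrow> f x \<le> 1"
  shows "L f \<le> (\<integral>x. f x \<partial>riesz_measure)"
proof (rule field_le_epsilon)
  fix e :: real assume "e > 0"
  then obtain m where m: "inverse (real (Suc m)) < e"
    using reals_Archimedean by blast
  define n where "n = Suc m"
  \<comment> \<open>With d = 1/n the n layers exactly exhaust the range [0,1] of \<open>f\<close>,
    and a single layer is thinner than \<open>e\<close>.\<close>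
  define d where "d = 1 / real n"
  have d: "0 < d" "d < e" "real n * d = 1"
    using m by (auto simp: d_def n_def inverse_eq_divide)
  define s where "s k x = min (max (f x - real k * d) 0) d" for k x
  define U where "U k = {x \<in> topspace X. f x \<in> {real k * d<..}}" for k
  have U: "openin X (U k)" for k
    unfolding U_def using f(1) by (intro openin_continuous_map_preimage) auto
  have s: "continuous_map X euclideanreal (s k)" for k
    unfolding s_def using f(1) by (intro continuous_intros) auto
  have fs: "f x = (\<Sum>k<n. s k x)" if "x \<in> topspace X" for x
    using sum_slices[of "f x" d n] f(2,3)[OF that] d by (simp add: s_def)
  have mU: "L (s k) \<le> d * measure riesz_measure (U k)" for k
  proof -
    have "(\<lambda>x. (1/d) * s k x) \<in> bumps (U k)"
      using d by (intro bumpsI continuous_map_real_mult_left[OF s]) (auto simp: s_def U_def min_def)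
    then have "ennreal (L (\<lambda>x. (1/d) * s k x)) \<le> emeasure riesz_measure (U k)"
      unfolding emeasure_riesz_open[OF U] by (rule bump_le_open_mass)
    then have "L (\<lambda>x. (1/d) * s k x) \<le> measure riesz_measure (U k)"
      by (simp add: finite_measure.emeasure_eq_measure[OF finite_riesz])
    then show ?thesis
      using d L_scale[OF s, of "1/d" k] by (simp add: pos_divide_le_eq mult.commute)
  qed
  have int_U: "integrable riesz_measure (indicator (U k) :: 'x \<Rightarrow> real)" for k
    using finite_measure.emeasure_finite[OF finite_riesz] sets.Int_space_eq2[OF open_in_sets[OF U]] open_in_sets[OF U]
    by (simp add: integrable_indicator_iff less_top)
  have "L f \<le> L (\<lambda>x. \<Sum>k<n. s k x)"
    using f(1) s fs by (intro L_mono continuous_map_sum) auto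
  also have "\<dots> = (\<Sum>k<n. L (s k))"
    using s by (intro L_sum) auto
  also have "\<dots> \<le> (\<Sum>k<n. d * measure riesz_measure (U k))"
    by (intro sum_mono mU)
  also have "\<dots> = (\<integral>x. (\<Sum>k<n. d * indicator (U k) x) \<partial>riesz_measure)"
    using int_U open_in_sets[OF U, THEN sets.sets_into_space]
    by (subst Bochner_Integration.integral_sum) (auto simp: Int_absorb2)
  also have "\<dots> \<le> (\<integral>x. f x + d \<partial>riesz_measure)"
  proof (rule integral_mono)
    show "integrable riesz_measure (\<lambda>x. \<Sum>k<n. d * indicator (U k) x)"
      by (intro Bochner_Integration.integrable_sum integrable_mult_right int_U)
    show "integrable riesz_measure (\<lambda>x. f x + d)"
      using f(1) by (intro regular_borel_integrable[OF compact regular_riesz] continuous_intros) auto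
    fix x assume "x \<in> space riesz_measure"
    then have x: "x \<in> topspace X" by simp
    \<comment> \<open>The first indicator is split off because on \<open>U (Suc k)\<close> the
      preceding layer \<open>s k\<close> is full, that is, equal to \<open>d\<close>. The shifted
      indicators are thus bounded by the layers of \<open>f\<close>, and the loss is one
      \<open>d\<close>.\<close>
    have "(\<Sum>k<n. d * indicator (U k) x) = d * indicator (U 0) x + (\<Sum>k<m. d * indicator (U (Suc k)) x)"
      unfolding n_def by (rule sum.lessThan_Suc_shift)
    also have "\<dots> \<le> d + (\<Sum>k<m. s k x)"
      using d by (intro add_mono sum_mono) (auto simp: indicator_def U_def s_def algebra_simps)
    also have "(\<Sum>k<m. s k x) \<le> (\<Sum>k<n. s k x)"
      using d by (auto simp: n_def s_def)
    finally show "(\<Sum>k<n. d * indicator (U k) x) \<le> f x + d"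
      using fs[OF x] by simp
  qed
  also have "\<dots> = (\<integral>x. f x \<partial>riesz_measure) + d"
    using regular_borel_integrable[OF compact regular_riesz f(1)] finite_riesz
    by (simp add: finite_measure.integrable_const measure_def emeasure_riesz_space)
  finally show "L f \<le> (\<integral>x. f x \<partial>riesz_measure) + e"
    using d by simp
qed

text \<open>The reverse inequality is \<open>L_le_integral\<close> for 1 - f, as \<open>L\<close>
  and the integral agree on constants.\<close>

lemma L_eq_integral_unit:
  assumes f: "continuous_map X euclideanreal f" "\<And>x. x \<in> topspace X \<Longrightarrow> 0 \<le> f x"
    "\<And>x. x \<in> topspace X \<Longrightarrow> f x \<le> 1"
  shows "L f = (\<integral>x. f x \<partial>riesz_measure)"
proof (rule antisym)
  show "L f \<le> (\<integral>x. f x \<partial>riesz_measure)"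
    by (rule L_le_integral[OF assms])
  have "L (\<lambda>x. 1 - f x) \<le> (\<integral>x. 1 - f x \<partial>riesz_measure)"
    using f by (intro L_le_integral continuous_intros) auto
  then show "(\<integral>x. f x \<partial>riesz_measure) \<le> L f"
    using regular_borel_integrable[OF compact regular_riesz f(1)] finite_riesz L_diff[of "\<lambda>_. 1" f] f(1)
    by (simp add: L_const finite_measure.integrable_const measure_def emeasure_riesz_space)
qed

lemma L_eq_integral:
  assumes f: "continuous_map X euclideanreal f"
  shows "L f = (\<integral>x. f x \<partial>riesz_measure)"
proof -
  obtain B where "B > 0" "\<And>x. x \<in> topspace X \<Longrightarrow> norm (f x) \<le> B"
    using continuous_bounded[OF compact f] by blast
  then have B: "\<And>x. x \<in> topspace X \<Longrightarrow> \<bar>f x\<bar> \<le> B" "B > 0"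
    by simp_all
  \<comment> \<open>Affine rescaling from [-B, B] to [0, 1].\<close>
  let ?g = "\<lambda>x. (1 / (2*B)) * (f x + B)"
  have g: "continuous_map X euclideanreal ?g"
    using f by (intro continuous_map_real_mult_left continuous_intros) auto
  have "L ?g = (\<integral>x. ?g x \<partial>riesz_measure)"
  proof (rule L_eq_integral_unit[OF g])
    fix x assume "x \<in> topspace X"
    then have "- B \<le> f x" "f x \<le> B"
      using B(1)[of x] by linarith+
    then show "0 \<le> ?g x" "?g x \<le> 1"
      using B(2) by (simp_all add: pos_divide_le_eq)
  qed
  moreover have "L ?g = (1 / (2*B)) * (L f + B)"
    using L_scale[of "\<lambda>x. f x + B" "1 / (2*B)"] L_add[OF f, of "\<lambda>_. B"] f
    by (simp add: L_const continuous_map_add)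
  moreover have "(\<integral>x. f x + B \<partial>riesz_measure) = (\<integral>x. f x \<partial>riesz_measure) + B"
    using regular_borel_integrable[OF compact regular_riesz f] finite_riesz
    by (simp add: finite_measure.integrable_const measure_def emeasure_riesz_space)
  then have "(\<integral>x. ?g x \<partial>riesz_measure) = (1 / (2*B)) * ((\<integral>x. f x \<partial>riesz_measure) + B)"
    by (simp only: integral_mult_right_zero)
  ultimately show ?thesis
    using B(2) by simp
qed

end

section \<open>Means of functions on a group\<close>

text \<open>Lists, not finite sets: products of group elements may coincide and must be counted with
  multiplicity. The average over the empty list is 0, whence the nonemptiness conditions
  below.\<close>

definition avg :: "'a list \<Rightarrow> ('a \<Rightarrow> 'b::real_normed_vector) \<Rightarrow> 'b"
  where "avg P F = (\<Sum>p\<leftarrow>P. F p) /\<^sub>R real (length P)"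

lemma product_eq_Nil: "List.product P Q = [] \<longleftrightarrow> P = [] \<or> Q = []"
  by (induction P) auto

lemma avg_map: "avg (map h P) F = avg P (\<lambda>p. F (h p))"
  by (simp add: avg_def o_def)

lemma avg_cong: "(\<And>p. p \<in> set P \<Longrightarrow> F p = G p) \<Longrightarrow> avg P F = avg P G"
  unfolding avg_def by (metis (mono_tags, lifting) map_eq_conv)

lemma avg_const: "P \<noteq> [] \<Longrightarrow> avg P (\<lambda>_. c) = c"
proof -
  have "(\<Sum>p\<leftarrow>P. c) = real (length P) *\<^sub>R c"
    by (induction P) (auto simp: scaleR_add_left)
  then show "P \<noteq> [] \<Longrightarrow> avg P (\<lambda>_. c) = c"
    by (simp add: avg_def)
qed

lemma avg_linear:
  assumes "bounded_linear h"
  shows "avg P (\<lambda>p. h (F p)) = h (avg P F)"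
proof -
  interpret bounded_linear h by fact
  have "(\<Sum>p\<leftarrow>P. h (F p)) = h (\<Sum>p\<leftarrow>P. F p)"
    by (induction P) (auto simp: add zero)
  then show ?thesis by (simp add: avg_def scaleR)
qed

lemma avg_add: "avg P (\<lambda>p. F p + G p) = avg P F + avg P G"
  by (simp add: avg_def sum_list_addf scaleR_add_right)

lemma avg_diff: "avg P (\<lambda>p. F p - G p) = avg P F - avg P G"
  by (simp add: avg_def sum_list_subtractf scaleR_diff_right)

lemma avg_sum: "avg P (\<lambda>p. \<Sum>i\<in>I. F i p) = (\<Sum>i\<in>I. avg P (F i))"
proof (induction I rule: infinite_finite_induct)
  case (insert i I)
  then show ?case by (simp add: avg_add)
qed (simp_all add: avg_def)

lemma avg_product: "avg (List.product P Q) F = avg P (\<lambda>p. avg Q (\<lambda>q. F (p, q)))"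
proof -
  have "(\<Sum>r\<leftarrow>List.product P Q. F r) = (\<Sum>p\<leftarrow>P. \<Sum>q\<leftarrow>Q. F (p, q))"
    by (induction P) (auto simp: o_def)
  moreover have "(\<Sum>p\<leftarrow>P. (\<Sum>q\<leftarrow>Q. F (p, q)) /\<^sub>R real (length Q)) =
      (\<Sum>p\<leftarrow>P. \<Sum>q\<leftarrow>Q. F (p, q)) /\<^sub>R real (length Q)"
    by (induction P) (auto simp: scaleR_add_right)
  ultimately show ?thesis
    by (simp add: avg_def)
qed

lemma avg_swap: "avg P (\<lambda>p. avg Q (\<lambda>q. F p q)) = avg Q (\<lambda>q. avg P (\<lambda>p. F p q))"
proof -
  have "(\<Sum>p\<leftarrow>P. avg Q (F p)) = avg Q (\<lambda>q. \<Sum>p\<leftarrow>P. F p q)" for P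
    by (induction P) (auto simp: avg_add, simp add: avg_def)
  then show ?thesis
    using avg_linear[OF bounded_linear_scaleR_right, of Q "inverse (real (length P))" "\<lambda>q. \<Sum>p\<leftarrow>P. F p q"]
    by (simp add: avg_def[of P])
qed

lemma avg_norm_le:
  assumes "P \<noteq> []" "\<And>p. p \<in> set P \<Longrightarrow> norm (F p) \<le> e"
  shows "norm (avg P F) \<le> e"
proof -
  have "norm (\<Sum>p\<leftarrow>P. F p) \<le> real (length P) * e"
    using assms(2)
  proof (induction P)
    case (Cons a P)
    have "norm (F a + (\<Sum>p\<leftarrow>P. F p)) \<le> e + real (length P) * e"
      using Cons by (intro norm_triangle_mono) auto
    then show ?case by (simp add: algebra_simps)
  qed simp
  then show ?thesis
    using assms(1) by (simp add: avg_def field_simps)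
qed

lemma avg_dist_le:
  assumes "P \<noteq> []" "\<And>p. p \<in> set P \<Longrightarrow> dist (F p) (G p) \<le> e"
  shows "dist (avg P F) (avg P G) \<le> e"
  using avg_norm_le[of P "\<lambda>p. F p - G p" e] assms by (simp add: dist_norm avg_diff)

lemma avg_near:
  assumes "P \<noteq> []" "\<And>p. p \<in> set P \<Longrightarrow> dist (F p) c \<le> e"
  shows "dist (avg P F) c \<le> e"
  using avg_dist_le[of P F "\<lambda>_. c" e] assms by (simp add: avg_const)

lemma avg_mono:
  fixes F :: "'a \<Rightarrow> real"
  assumes "\<And>p. p \<in> set P \<Longrightarrow> F p \<le> G p"
  shows "avg P F \<le> avg P G"
  using assms unfolding avg_def by (intro scaleR_left_mono sum_list_mono) auto

text \<open>The deficits \<open>u - F p\<close> are nonnegative, so each is at most their sum, which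
  is the length times the average deficit. An average close to a common upper bound thus forces all
  entries close to it at once.\<close>

lemma avg_concentration:
  fixes F :: "'a \<Rightarrow> real"
  assumes F: "\<And>p. p \<in> set Q \<Longrightarrow> F p \<le> u" and v: "v < avg Q F" and x: "x \<in> set Q"
  shows "u - real (length Q) * (u - v) \<le> F x"
proof -
  have *: "u - F x \<le> (\<Sum>p\<leftarrow>Q. u - F p)"
    using F x
  proof (induction Q)
    case (Cons a Q)
    have "0 \<le> (\<Sum>p\<leftarrow>Q. u - F p)"
      using Cons.prems(1) by (intro sum_list_nonneg) auto
    then show ?case using Cons by fastforce
  qed simp
  have n: "0 < real (length Q)" using x by auto
  have "Q \<noteq> []" using x by auto
  then have "avg Q (\<lambda>p. u - F p) = u - avg Q F"
    by (simp add: avg_diff avg_const)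
  moreover have "(\<Sum>p\<leftarrow>Q. u - F p) = real (length Q) * avg Q (\<lambda>p. u - F p)"
    using n by (simp add: avg_def)
  ultimately have "(\<Sum>p\<leftarrow>Q. u - F p) = real (length Q) * (u - avg Q F)"
    by simp
  also have "\<dots> \<le> real (length Q) * (u - v)"
    using v by (intro mult_left_mono) auto
  finally show ?thesis using * by simp
qed

text \<open>The condition behind von Neumann's mean value: one list must serve all left and right
  translates simultaneously.\<close>

definition averaging_list :: "('g, 'm) monoid_scheme \<Rightarrow> ('g \<Rightarrow> 'b::real_normed_vector) \<Rightarrow> 'b \<Rightarrow> real \<Rightarrow> 'g list \<Rightarrow> bool"
  where "averaging_list G f c e P \<longleftrightarrow> P \<noteq> [] \<and> set P \<subseteq> carrier G \<and>
    (\<forall>a\<in>carrier G. \<forall>b\<in>carrier G. dist (avg P (\<lambda>p. f (a \<otimes>\<^bsub>G\<^esub> p \<otimes>\<^bsub>G\<^esub> b))) c \<le> e)"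

definition has_mean :: "('g, 'm) monoid_scheme \<Rightarrow> ('g \<Rightarrow> 'b::real_normed_vector) \<Rightarrow> 'b \<Rightarrow> bool"
  where "has_mean G f c \<longleftrightarrow> (\<forall>e>0. \<exists>P. averaging_list G f c e P)"

text \<open>Total boundedness of the right translates of \<open>f\<close>, with the centres of the
  net given by group elements and the choice of a centre made part of the data.\<close>

definition net_map :: "('g, 'm) monoid_scheme \<Rightarrow> ('g \<Rightarrow> 'b::real_normed_vector) \<Rightarrow> real \<Rightarrow> ('g \<Rightarrow> 'g) \<Rightarrow> bool"
  where "net_map G f e s \<longleftrightarrow> finite (s ` carrier G) \<and> s ` carrier G \<subseteq> carrier G \<and>
    (\<forall>g\<in>carrier G. \<forall>h\<in>carrier G. dist (f (h \<otimes>\<^bsub>G\<^esub> g)) (f (h \<otimes>\<^bsub>G\<^esub> s g)) \<le> e)"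

definition finite_nets :: "('g, 'm) monoid_scheme \<Rightarrow> ('g \<Rightarrow> 'b::real_normed_vector) \<Rightarrow> bool"
  where "finite_nets G f \<longleftrightarrow> (\<forall>e>0. \<exists>s. net_map G f e s)"

lemma averaging_listI:
  assumes "P \<noteq> []" "set P \<subseteq> carrier G"
    "\<And>a b. a \<in> carrier G \<Longrightarrow> b \<in> carrier G \<Longrightarrow> dist (avg P (\<lambda>p. f (a \<otimes>\<^bsub>G\<^esub> p \<otimes>\<^bsub>G\<^esub> b))) c \<le> e"
  shows "averaging_list G f c e P"
  using assms by (simp add: averaging_list_def)

lemma averaging_listD:
  assumes "averaging_list G f c e P"
  shows "P \<noteq> []" "set P \<subseteq> carrier G"
    "a \<in> carrier G \<Longrightarrow> b \<in> carrier G \<Longrightarrow> dist (avg P (\<lambda>p. f (a \<otimes>\<^bsub>G\<^esub> p \<otimes>\<^bsub>G\<^esub> b))) c \<le> e"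
  using assms by (simp_all add: averaging_list_def)

lemma has_meanI: "(\<And>e. e > 0 \<Longrightarrow> \<exists>P. averaging_list G f c e P) \<Longrightarrow> has_mean G f c"
  by (simp add: has_mean_def)

lemma has_meanD: "has_mean G f c \<Longrightarrow> e > 0 \<Longrightarrow> \<exists>P. averaging_list G f c e P"
  by (simp add: has_mean_def)

lemma net_mapD:
  assumes "net_map G f e s"
  shows "finite (s ` carrier G)" "g \<in> carrier G \<Longrightarrow> s g \<in> carrier G"
    "g \<in> carrier G \<Longrightarrow> h \<in> carrier G \<Longrightarrow> dist (f (h \<otimes>\<^bsub>G\<^esub> g)) (f (h \<otimes>\<^bsub>G\<^esub> s g)) \<le> e"
  using assms by (auto simp: net_map_def)

lemma finite_netsI: "(\<And>e. e > 0 \<Longrightarrow> \<exists>s. net_map G f e s) \<Longrightarrow> finite_nets G f"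
  by (simp add: finite_nets_def)

lemma finite_netsD: "finite_nets G f \<Longrightarrow> e > 0 \<Longrightarrow> \<exists>s. net_map G f e s"
  by (simp add: finite_nets_def)

text \<open>\<open>c\<close> is a colouring of the group by finitely many colours whose classes have
  diameter at most \<open>e\<close> in the sup norm of translates; one representative of each class
  serves as centre. Colours need not be group elements, so several nets can be combined by
  pairing.\<close>

lemma ex_net_map:
  assumes fin: "finite (c ` carrier G)"
    and c: "\<And>g g' h. g \<in> carrier G \<Longrightarrow> g' \<in> carrier G \<Longrightarrow> c g = c g' \<Longrightarrow> h \<in> carrier G \<Longrightarrow>
      dist (f (h \<otimes>\<^bsub>G\<^esub> g)) (f (h \<otimes>\<^bsub>G\<^esub> g')) \<le> e"
  shows "\<exists>s. net_map G f e s"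
proof (rule exI)
  let ?s = "\<lambda>g. inv_into (carrier G) c (c g)"
  have "?s ` carrier G = inv_into (carrier G) c ` c ` carrier G"
    by (simp add: image_image)
  then have "finite (?s ` carrier G)"
    using fin by simp
  moreover have s: "?s g \<in> carrier G" "c g = c (?s g)" if "g \<in> carrier G" for g
    using that by (simp_all add: inv_into_into f_inv_into_f)
  moreover have "dist (f (h \<otimes>\<^bsub>G\<^esub> g)) (f (h \<otimes>\<^bsub>G\<^esub> ?s g)) \<le> e" if "g \<in> carrier G" "h \<in> carrier G" for g h
    by (rule c[OF that(1) s[OF that(1)] that(2)])
  ultimately show "net_map G f e ?s"
    by (simp add: net_map_def image_subset_iff)
qed

section \<open>Mean values: uniqueness, linearity, positivity and translations\<close>

context group
begin

lemma has_mean_cong: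
  assumes f: "has_mean G f c" and fk: "\<And>h. h \<in> carrier G \<Longrightarrow> f h = k h"
  shows "has_mean G k c"
proof (rule has_meanI)
  fix e :: real assume "e > 0"
  then obtain P where P: "averaging_list G f c e P"
    using has_meanD[OF f] by blast
  note PD = averaging_listD[OF P]
  have "averaging_list G k c e P"
  proof (rule averaging_listI[OF PD(1,2)])
    fix a b assume ab: "a \<in> carrier G" "b \<in> carrier G"
    have "avg P (\<lambda>p. k (a \<otimes> p \<otimes> b)) = avg P (\<lambda>p. f (a \<otimes> p \<otimes> b))"
      using ab PD(2) fk by (intro avg_cong) (simp add: subset_iff)
    then show "dist (avg P (\<lambda>p. k (a \<otimes> p \<otimes> b))) c \<le> e"
      using PD(3)[OF ab] by simp
  qed
  then show "\<exists>P. averaging_list G k c e P" ..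
qed

text \<open>The products of two averaging lists average both functions, since either factor can be absorbed
  into the translation on its side.\<close>

lemma has_mean_joint:
  assumes f: "has_mean G f c" and k: "has_mean G k d" and e: "e > 0"
  shows "\<exists>R. averaging_list G f c e R \<and> averaging_list G k d e R"
proof -
  obtain P where "averaging_list G f c e P"
    using has_meanD[OF f e] by blast
  note P = averaging_listD[OF this]
  obtain Q where "averaging_list G k d e Q"
    using has_meanD[OF k e] by blast
  note Q = averaging_listD[OF this]
  let ?R = "map (\<lambda>(p, q). p \<otimes> q) (List.product P Q)"
  have R: "?R \<noteq> []" "set ?R \<subseteq> carrier G"
    using P(1,2) Q(1,2) by (auto simp: product_eq_Nil)
  have "averaging_list G f c e ?R"
  proof (rule averaging_listI[OF R])
    fix a b assume ab: "a \<in> carrier G" "b \<in> carrier G"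
    have "avg ?R (\<lambda>r. f (a \<otimes> r \<otimes> b)) = avg P (\<lambda>p. avg Q (\<lambda>q. f (a \<otimes> (p \<otimes> q) \<otimes> b)))"
      by (simp add: avg_map avg_product)
    also have "\<dots> = avg Q (\<lambda>q. avg P (\<lambda>p. f (a \<otimes> (p \<otimes> q) \<otimes> b)))"
      by (rule avg_swap)
    also have "\<dots> = avg Q (\<lambda>q. avg P (\<lambda>p. f (a \<otimes> p \<otimes> (q \<otimes> b))))"
      using P(2) Q(2) ab by (intro avg_cong) (simp add: m_assoc subset_iff)
    also have "dist \<dots> c \<le> e"
      using P(3) Q(1,2) ab by - (rule avg_near, simp_all add: subset_iff)
    finally show "dist (avg ?R (\<lambda>r. f (a \<otimes> r \<otimes> b))) c \<le> e" .
  qed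
  moreover have "averaging_list G k d e ?R"
  proof (rule averaging_listI[OF R])
    fix a b assume ab: "a \<in> carrier G" "b \<in> carrier G"
    have "avg ?R (\<lambda>r. k (a \<otimes> r \<otimes> b)) = avg P (\<lambda>p. avg Q (\<lambda>q. k (a \<otimes> (p \<otimes> q) \<otimes> b)))"
      by (simp add: avg_map avg_product)
    also have "\<dots> = avg P (\<lambda>p. avg Q (\<lambda>q. k (a \<otimes> p \<otimes> q \<otimes> b)))"
      using P(2) Q(2) ab by (intro avg_cong) (simp add: m_assoc subset_iff)
    also have "dist \<dots> d \<le> e"
      using Q(3) P(1,2) ab by - (rule avg_near, simp_all add: subset_iff)
    finally show "dist (avg ?R (\<lambda>r. k (a \<otimes> r \<otimes> b))) d \<le> e" .
  qed
  ultimately show ?thesis by blast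
qed

text \<open>A list averaging \<open>f\<close> to both values makes one and the same number close to
  \<open>c\<close> and to \<open>d\<close>.\<close>

lemma has_mean_unique:
  assumes "has_mean G f c" "has_mean G f d"
  shows "c = d"
proof -
  have "dist c d \<le> 0 + e" if e: "e > 0" for e
  proof -
    obtain R where R: "averaging_list G f c (e/2) R" "averaging_list G f d (e/2) R"
      using has_mean_joint[OF assms, of "e/2"] e by auto
    have "dist (avg R (\<lambda>r. f (\<one> \<otimes> r \<otimes> \<one>))) c \<le> e/2" "dist (avg R (\<lambda>r. f (\<one> \<otimes> r \<otimes> \<one>))) d \<le> e/2"
      using averaging_listD(3)[OF R(1) one_closed one_closed] averaging_listD(3)[OF R(2) one_closed one_closed] .
    then show ?thesis
      using dist_triangle3[of c d "avg R (\<lambda>r. f (\<one> \<otimes> r \<otimes> \<one>))"] by simp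
  qed
  then have "dist c d \<le> 0" by (rule field_le_epsilon)
  then show ?thesis by simp
qed

lemma has_mean_add:
  assumes "has_mean G f c" "has_mean G k d"
  shows "has_mean G (\<lambda>h. f h + k h) (c + d)"
proof (rule has_meanI)
  fix e :: real assume "e > 0"
  then obtain R where R: "averaging_list G f c (e/2) R" "averaging_list G k d (e/2) R"
    using has_mean_joint[OF assms, of "e/2"] by auto
  have "averaging_list G (\<lambda>h. f h + k h) (c + d) e R"
  proof (rule averaging_listI[OF averaging_listD(1,2)[OF R(1)]])
    fix a b assume "a \<in> carrier G" "b \<in> carrier G"
    then show "dist (avg R (\<lambda>r. f (a \<otimes> r \<otimes> b) + k (a \<otimes> r \<otimes> b))) (c + d) \<le> e"
      using averaging_listD(3)[OF R(1), of a b] averaging_listD(3)[OF R(2), of a b] unfolding avg_add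
      by (intro order_trans[OF dist_triangle_add]) linarith
  qed
  then show "\<exists>P. averaging_list G (\<lambda>h. f h + k h) (c + d) e P" ..
qed

lemma has_mean_linear:
  assumes "bounded_linear h" "has_mean G f c"
  shows "has_mean G (\<lambda>x. h (f x)) (h c)"
proof (rule has_meanI)
  fix e :: real assume e: "e > 0"
  interpret bounded_linear h by fact
  obtain K where K: "K > 0" "\<And>x. norm (h x) \<le> norm x * K"
    using pos_bounded by blast
  have "e / K > 0" using e K by simp
  then obtain P where P: "averaging_list G f c (e / K) P"
    using has_meanD[OF assms(2)] by blast
  have "averaging_list G (\<lambda>x. h (f x)) (h c) e P"
  proof (rule averaging_listI[OF averaging_listD(1,2)[OF P]])
    fix a b assume ab: "a \<in> carrier G" "b \<in> carrier G"
    have "norm (h (avg P (\<lambda>p. f (a \<otimes> p \<otimes> b)) - c)) \<le> e"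
      using averaging_listD(3)[OF P ab] K(1)
      by (intro order_trans[OF K(2)]) (simp add: dist_norm pos_le_divide_eq)
    then show "dist (avg P (\<lambda>p. h (f (a \<otimes> p \<otimes> b)))) (h c) \<le> e"
      by (simp add: avg_linear[OF assms(1)] dist_norm diff)
  qed
  then show "\<exists>P. averaging_list G (\<lambda>x. h (f x)) (h c) e P" ..
qed

lemma has_mean_translate:
  assumes f: "has_mean G f c" and uv: "u \<in> carrier G" "v \<in> carrier G"
  shows "has_mean G (\<lambda>h. f (u \<otimes> h \<otimes> v)) c"
proof (rule has_meanI)
  fix e :: real assume "e > 0"
  then obtain P where "averaging_list G f c e P"
    using has_meanD[OF f] by blast
  note P = averaging_listD[OF this]
  have "averaging_list G (\<lambda>h. f (u \<otimes> h \<otimes> v)) c e P"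
  proof (rule averaging_listI[OF P(1,2)])
    fix a b assume ab: "a \<in> carrier G" "b \<in> carrier G"
    have "avg P (\<lambda>p. f (u \<otimes> (a \<otimes> p \<otimes> b) \<otimes> v)) = avg P (\<lambda>p. f ((u \<otimes> a) \<otimes> p \<otimes> (b \<otimes> v)))"
      using P(2) uv ab by (intro avg_cong) (simp add: m_assoc subset_iff)
    then show "dist (avg P (\<lambda>p. f (u \<otimes> (a \<otimes> p \<otimes> b) \<otimes> v))) c \<le> e"
      using P(3)[of "u \<otimes> a" "b \<otimes> v"] uv ab by simp
  qed
  then show "\<exists>P. averaging_list G (\<lambda>h. f (u \<otimes> h \<otimes> v)) c e P" ..
qed

lemma has_mean_nonneg:
  fixes f :: "'a \<Rightarrow> real"
  assumes f: "has_mean G f c" and nn: "\<And>h. h \<in> carrier G \<Longrightarrow> 0 \<le> f h"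
  shows "0 \<le> c"
proof (rule field_le_epsilon)
  fix e :: real assume "e > 0"
  then obtain P where "averaging_list G f c e P"
    using has_meanD[OF f] by blast
  note P = averaging_listD[OF this]
  have "avg P (\<lambda>_. 0) \<le> avg P (\<lambda>p. f (\<one> \<otimes> p \<otimes> \<one>))"
    using P(2) nn by (intro avg_mono) (simp add: subset_iff)
  then show "0 \<le> c + e"
    using P(1) P(3)[OF one_closed one_closed] by (simp add: avg_const dist_real_def)
qed

lemma has_mean_const: "has_mean G (\<lambda>_. c) c"
  by (intro has_meanI exI[of _ "[\<one>]"]) (simp add: averaging_list_def avg_def)

section \<open>Closure properties of functions with finite nets\<close>

lemma finite_nets_add:
  assumes "finite_nets G f" "finite_nets G k"
  shows "finite_nets G (\<lambda>h. f h + k h)"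
proof (rule finite_netsI)
  fix e :: real assume e: "e > 0"
  \<comment> \<open>Translates by \<open>g\<close> and \<open>g'\<close> are compared through their
    common net point: two legs of \<open>e/4\<close> for each of the two functions.\<close>
  obtain s where "net_map G f (e/4) s"
    using finite_netsD[OF assms(1), of "e/4"] e by auto
  note s = net_mapD[OF this]
  obtain t where "net_map G k (e/4) t"
    using finite_netsD[OF assms(2), of "e/4"] e by auto
  note t = net_mapD[OF this]
  show "\<exists>s. net_map G (\<lambda>h. f h + k h) e s"
  proof (rule ex_net_map[where c = "\<lambda>g. (s g, t g)"])
    have "(\<lambda>g. (s g, t g)) ` carrier G \<subseteq> s ` carrier G \<times> t ` carrier G"
      by (rule image_subsetI) simp
    then show "finite ((\<lambda>g. (s g, t g)) ` carrier G)"
      by (rule finite_subset) (intro finite_cartesian_product s(1) t(1))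
    fix g g' h assume g: "g \<in> carrier G" "g' \<in> carrier G" and st: "(s g, t g) = (s g', t g')" and h: "h \<in> carrier G"
    have eq: "s g' = s g" "t g' = t g" using st by simp_all
    have "dist (f (h \<otimes> g)) (f (h \<otimes> g')) \<le> e/2"
      using s(3)[OF g(1) h] s(3)[OF g(2) h, unfolded eq]
        dist_triangle2[of "f (h \<otimes> g)" "f (h \<otimes> g')" "f (h \<otimes> s g)"] by linarith
    moreover have "dist (k (h \<otimes> g)) (k (h \<otimes> g')) \<le> e/2"
      using t(3)[OF g(1) h] t(3)[OF g(2) h, unfolded eq]
        dist_triangle2[of "k (h \<otimes> g)" "k (h \<otimes> g')" "k (h \<otimes> t g)"] by linarith
    ultimately show "dist (f (h \<otimes> g) + k (h \<otimes> g)) (f (h \<otimes> g') + k (h \<otimes> g')) \<le> e"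
      using dist_triangle_add[of "f (h \<otimes> g)" "k (h \<otimes> g)" "f (h \<otimes> g')" "k (h \<otimes> g')"] by linarith
  qed
qed

lemma finite_nets_linear:
  assumes "bounded_linear L" "finite_nets G f"
  shows "finite_nets G (\<lambda>h. L (f h))"
proof (rule finite_netsI)
  fix e :: real assume e: "e > 0"
  interpret bounded_linear L by fact
  obtain K where K: "K > 0" "\<And>x. norm (L x) \<le> norm x * K"
    using pos_bounded by blast
  have "e / K > 0" using e K by simp
  then obtain s where s: "net_map G f (e / K) s"
    using finite_netsD[OF assms(2)] by blast
  have *: "dist (L x) (L y) \<le> e" if "dist x y \<le> e / K" for x y
  proof -
    have "norm (L (x - y)) \<le> e"
      using that K(1) by (intro order_trans[OF K(2)]) (simp add: dist_norm pos_le_divide_eq)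
    then show ?thesis by (simp add: dist_norm diff)
  qed
  have "net_map G (\<lambda>h. L (f h)) e s"
    using s by (simp add: net_map_def *)
  then show "\<exists>s. net_map G (\<lambda>h. L (f h)) e s" by blast
qed

lemma finite_nets_const: "finite_nets G (\<lambda>_. c)"
  by (intro finite_netsI ex_net_map[where c = "\<lambda>_. ()"]) simp_all

lemma finite_nets_cong:
  assumes "finite_nets G f" "\<And>h. h \<in> carrier G \<Longrightarrow> f h = k h"
  shows "finite_nets G k"
proof (rule finite_netsI)
  fix e :: real assume "e > 0"
  then obtain s where s: "net_map G f e s"
    using finite_netsD[OF assms(1)] by blast
  then have "net_map G k e s"
    using assms(2)[symmetric] by (simp add: net_map_def image_subset_iff)
  then show "\<exists>s. net_map G k e s" by blast
qed

text \<open>At h = 1 the net estimate says that every value of \<open>f\<close> is within 1 of one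
  of finitely many values.\<close>

lemma finite_nets_bounded:
  assumes "finite_nets G f"
  shows "\<exists>B. \<forall>h\<in>carrier G. norm (f h) \<le> B"
proof -
  obtain s where "net_map G f 1 s"
    using finite_netsD[OF assms zero_less_one] by blast
  note s = net_mapD[OF this]
  have "norm (f g) \<le> (\<Sum>t\<in>s ` carrier G. norm (f t)) + 1" if g: "g \<in> carrier G" for g
  proof -
    have "norm (f (s g)) \<le> (\<Sum>t\<in>s ` carrier G. norm (f t))"
      using g s(1) by (intro member_le_sum) auto
    moreover have "dist (f g) (f (s g)) \<le> 1"
      using s(2)[OF g] s(3)[OF g one_closed] g by simp
    moreover have "norm (f g) \<le> norm (f (s g)) + norm (f g - f (s g))"
      by (rule norm_triangle_sub)
    ultimately show ?thesis
      by (simp add: dist_norm)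
  qed
  then show ?thesis by blast
qed

lemma finite_nets_translate:
  assumes f: "finite_nets G f" and v: "v \<in> carrier G"
  shows "finite_nets G (\<lambda>h. f (h \<otimes> v))"
proof (rule finite_netsI)
  fix e :: real assume e: "e > 0"
  obtain s where "net_map G f (e/2) s"
    using finite_netsD[OF f, of "e/2"] e by auto
  note s = net_mapD[OF this]
  show "\<exists>s. net_map G (\<lambda>h. f (h \<otimes> v)) e s"
  proof (rule ex_net_map[where c = "\<lambda>g. s (g \<otimes> v)"])
    have "(\<lambda>g. s (g \<otimes> v)) ` carrier G \<subseteq> s ` carrier G"
      using v by (intro image_subsetI imageI m_closed)
    then show "finite ((\<lambda>g. s (g \<otimes> v)) ` carrier G)"
      by (rule finite_subset) (rule s(1))
    fix g g' h assume g: "g \<in> carrier G" "g' \<in> carrier G" and eq: "s (g \<otimes> v) = s (g' \<otimes> v)" and h: "h \<in> carrier G"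
    have "dist (f (h \<otimes> (g \<otimes> v))) (f (h \<otimes> (g' \<otimes> v))) \<le> e"
      using s(3)[OF m_closed[OF g(1) v] h] s(3)[OF m_closed[OF g(2) v] h, folded eq]
        dist_triangle2[of "f (h \<otimes> (g \<otimes> v))" "f (h \<otimes> (g' \<otimes> v))" "f (h \<otimes> s (g \<otimes> v))"]
      by linarith
    then show "dist (f (h \<otimes> g \<otimes> v)) (f (h \<otimes> g' \<otimes> v)) \<le> e"
      using g h v by (simp add: m_assoc)
  qed
qed

text \<open>Group elements are classified by the net points of their translates by the finitely many
  points of a net; this makes the approximation uniform from both sides.\<close>

lemma finite_nets_two_sided:
  assumes f: "finite_nets G f" and e: "e > 0"
  shows "\<exists>r. finite (r ` carrier G) \<and> r ` carrier G \<subseteq> carrier G \<and>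
    (\<forall>g\<in>carrier G. \<forall>a\<in>carrier G. \<forall>b\<in>carrier G. dist (f (a \<otimes> g \<otimes> b)) (f (a \<otimes> r g \<otimes> b)) \<le> e)"
proof -
  obtain s where "net_map G f (e/4) s"
    using finite_netsD[OF f, of "e/4"] e by auto
  note s = net_mapD[OF this]
  define T where "T = s ` carrier G"
  have T: "finite T" "T \<subseteq> carrier G" using s(1,2) by (auto simp: T_def)
  \<comment> \<open>Restricting to \<open>T\<close> makes the table extensional, so only finitely
    many tables exist.\<close>
  define c where "c g = (\<lambda>t\<in>T. s (g \<otimes> t))" for g
  have "c ` carrier G \<subseteq> PiE T (\<lambda>_. T)"
    using T(2) by (auto simp: c_def T_def)
  then have fin: "finite (c ` carrier G)"
    by (rule finite_subset) (intro finite_PiE T(1))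
  have close: "dist (f (a \<otimes> g \<otimes> b)) (f (a \<otimes> g' \<otimes> b)) \<le> e"
    if g: "g \<in> carrier G" "g' \<in> carrier G" "c g = c g'" and ab: "a \<in> carrier G" "b \<in> carrier G" for g g' a b
  proof -
    let ?t = "s b"
    have t: "?t \<in> T" "?t \<in> carrier G"
      using ab s(2) by (auto simp: T_def)
    have eq: "s (g \<otimes> ?t) = s (g' \<otimes> ?t)"
      using fun_cong[OF g(3), of ?t] t(1) by (simp add: c_def)
    \<comment> \<open>First \<open>b\<close> is replaced by its net point t, then g t and g' t by
      their common net point: two legs of \<open>e/4\<close> from each of \<open>g\<close> and
      \<open>g'\<close>.\<close>
    have "dist (f (a \<otimes> g \<otimes> b)) (f (a \<otimes> g \<otimes> ?t)) \<le> e/4" "dist (f (a \<otimes> g' \<otimes> b)) (f (a \<otimes> g' \<otimes> ?t)) \<le> e/4"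
      using s(3)[of b "a \<otimes> g"] s(3)[of b "a \<otimes> g'"] ab g by simp_all
    moreover have "dist (f (a \<otimes> g \<otimes> ?t)) (f (a \<otimes> s (g \<otimes> ?t))) \<le> e/4"
        "dist (f (a \<otimes> g' \<otimes> ?t)) (f (a \<otimes> s (g \<otimes> ?t))) \<le> e/4"
      using s(3)[of "g \<otimes> ?t" a] s(3)[of "g' \<otimes> ?t" a] ab g(1,2) t(2) eq by (simp_all add: m_assoc)
    ultimately show ?thesis
      using dist_triangle2[of "f (a \<otimes> g \<otimes> ?t)" "f (a \<otimes> g' \<otimes> ?t)" "f (a \<otimes> s (g \<otimes> ?t))"]
        dist_triangle[of "f (a \<otimes> g \<otimes> b)" "f (a \<otimes> g' \<otimes> ?t)" "f (a \<otimes> g \<otimes> ?t)"]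
        dist_triangle2[of "f (a \<otimes> g \<otimes> b)" "f (a \<otimes> g' \<otimes> b)" "f (a \<otimes> g' \<otimes> ?t)"]
      by linarith
  qed
  let ?r = "\<lambda>g. inv_into (carrier G) c (c g)"
  have "?r ` carrier G = inv_into (carrier G) c ` c ` carrier G"
    by (simp add: image_image)
  then have "finite (?r ` carrier G)"
    using fin by simp
  moreover have r: "?r g \<in> carrier G" "c g = c (?r g)" if "g \<in> carrier G" for g
    using that by (simp_all add: inv_into_into f_inv_into_f)
  moreover have "dist (f (a \<otimes> g \<otimes> b)) (f (a \<otimes> ?r g \<otimes> b)) \<le> e"
    if "g \<in> carrier G" "a \<in> carrier G" "b \<in> carrier G" for g a b
    by (rule close[OF that(1) r[OF that(1)] that(2,3)])
  ultimately show ?thesis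
    by (intro exI[of _ ?r]) (simp add: image_subset_iff)
qed

text \<open>The mean is the infimum \<open>s\<close> of all upper bounds of two-sided averages. If an average \<open>K\<close> is
  bounded by \<open>s + d\<close>, then averaging its translates by a finite net shows that \<open>K\<close> is close to \<open>s\<close> at
  all translates by net points simultaneously, hence everywhere.\<close>

lemma has_mean_exists_real:
  fixes f :: "'a \<Rightarrow> real"
  assumes f: "finite_nets G f"
  shows "\<exists>c. has_mean G f c"
proof -
  obtain B where B: "\<forall>h\<in>carrier G. norm (f h) \<le> B"
    using finite_nets_bounded[OF f] ..
  define bound where "bound P u \<longleftrightarrow> P \<noteq> [] \<and> set P \<subseteq> carrier G \<and>
    (\<forall>a\<in>carrier G. \<forall>b\<in>carrier G. avg P (\<lambda>p. f (a \<otimes> p \<otimes> b)) \<le> u)" for P u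
  define U where "U = {u. \<exists>P. bound P u}"
  have "bound [\<one>] B"
    using B by (simp add: bound_def avg_def abs_le_iff)
  then have BU: "B \<in> U"
    unfolding U_def by blast
  have bdd: "bdd_below U"
  proof (rule bdd_belowI)
    fix u assume "u \<in> U"
    then obtain P where "bound P u"
      unfolding U_def by blast
    then have P: "P \<noteq> []" "set P \<subseteq> carrier G" "avg P (\<lambda>p. f (\<one> \<otimes> p \<otimes> \<one>)) \<le> u"
      by (simp_all add: bound_def)
    have "avg P (\<lambda>_. - B) \<le> avg P (\<lambda>p. f (\<one> \<otimes> p \<otimes> \<one>))"
    proof (rule avg_mono)
      fix p assume "p \<in> set P"
      then have "p \<in> carrier G" using P(2) by blast
      then show "- B \<le> f (\<one> \<otimes> p \<otimes> \<one>)" using bspec[OF B, of p] by (simp add: abs_le_iff)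
    qed
    then show "- B \<le> u" using P(1,3) by (simp add: avg_const)
  qed
  define s where "s = Inf U"
  have "has_mean G f s"
  proof (rule has_meanI)
    fix e :: real assume e: "e > 0"
    obtain r where r: "finite (r ` carrier G)" "r ` carrier G \<subseteq> carrier G"
      "\<forall>g\<in>carrier G. \<forall>a\<in>carrier G. \<forall>b\<in>carrier G. dist (f (a \<otimes> g \<otimes> b)) (f (a \<otimes> r g \<otimes> b)) \<le> e/4"
      using finite_nets_two_sided[OF f, of "e/4"] e by auto
    have rG: "r g \<in> carrier G" if "g \<in> carrier G" for g
      using r(2) that by blast
    have rb: "dist (f (a \<otimes> g \<otimes> b)) (f (a \<otimes> r g \<otimes> b)) \<le> e/4"
      if "g \<in> carrier G" "a \<in> carrier G" "b \<in> carrier G" for g a b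
      using r(3) that by blast
    obtain xs where xs: "set xs = r ` carrier G" using finite_list[OF r(1)] by blast
    have xsG: "set xs \<subseteq> carrier G" using xs r(2) by simp
    have "xs \<noteq> []" using xs one_closed by force
    \<comment> \<open>Pairs, since a two-sided translate needs one net point on the left and one on
      the right.\<close>
    define Q where "Q = List.product xs xs"
    define N where "N = real (length Q)"
    have Qne: "Q \<noteq> []" using \<open>xs \<noteq> []\<close> by (simp add: Q_def product_eq_Nil)
    then have N: "N \<ge> 1" by (cases Q) (auto simp: N_def)
    have QG: "fst q \<in> carrier G" "snd q \<in> carrier G" if "q \<in> set Q" for q
      using that xsG by (auto simp: Q_def)
    \<comment> \<open>Concentration over \<open>Q\<close> multiplies the gap 2d between s + d and s
      - d by \<open>N\<close>; this choice turns it into \<open>e/2\<close>.\<close>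
    define d where "d = e / (4 * N)"
    have "e / (4 * N) \<le> e / 4"
      using e N by (intro divide_left_mono) auto
    then have d: "0 < d" "d \<le> e" "N * (2 * d) = e / 2"
      using e N by (simp_all add: d_def)
    have "\<exists>u\<in>U. u < s + d"
      using cInf_less_iff[of U "s + d"] bdd BU d(1) by (auto simp: s_def)
    then obtain P u where "bound P u" "u < s + d"
      unfolding U_def by blast
    then have P: "P \<noteq> []" "set P \<subseteq> carrier G" and
      Pb: "\<And>a b. a \<in> carrier G \<Longrightarrow> b \<in> carrier G \<Longrightarrow> avg P (\<lambda>p. f (a \<otimes> p \<otimes> b)) \<le> s + d"
      by (force simp: bound_def)+
    have PG: "p \<in> carrier G" if "p \<in> set P" for p
      using that P(2) by blast
    define K where "K a b = avg P (\<lambda>p. f (a \<otimes> p \<otimes> b))" for a b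
    \<comment> \<open>Averaging over \<open>R\<close> amounts to averaging the translates of
      \<open>K\<close> by all net pairs.\<close>
    define R where "R = map (\<lambda>(q, p). fst q \<otimes> p \<otimes> snd q) (List.product Q P)"
    have R: "R \<noteq> []"
      using Qne P(1) by (simp add: R_def product_eq_Nil)
    have RG: "set R \<subseteq> carrier G"
    proof
      fix x assume "x \<in> set R"
      then obtain q p where "q \<in> set Q" "p \<in> set P" "x = fst q \<otimes> p \<otimes> snd q"
        by (auto simp: R_def)
      then show "x \<in> carrier G" using QG PG by simp
    qed
    \<comment> \<open>As \<open>s\<close> is the infimum, s - d cannot bound the averages over
      \<open>R\<close>. So some base point (a, b) has an average above s - d, although every entry
      is at most s + d.\<close>
    have "s - d \<notin> U"
      using cInf_lower[OF _ bdd, of "s - d"] d(1) by (auto simp: s_def)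
    then have "\<not> bound R (s - d)"
      unfolding U_def by blast
    then obtain a b where ab: "a \<in> carrier G" "b \<in> carrier G" "s - d < avg R (\<lambda>r. f (a \<otimes> r \<otimes> b))"
      using R RG unfolding bound_def by (meson not_le)
    have "avg R (\<lambda>r. f (a \<otimes> r \<otimes> b)) = avg Q (\<lambda>q. avg P (\<lambda>p. f (a \<otimes> (fst q \<otimes> p \<otimes> snd q) \<otimes> b)))"
      by (simp add: R_def avg_map avg_product)
    also have "\<dots> = avg Q (\<lambda>q. K (a \<otimes> fst q) (snd q \<otimes> b))"
      unfolding K_def using ab QG PG by (intro avg_cong) (simp add: m_assoc)
    finally have gt: "s - d < avg Q (\<lambda>q. K (a \<otimes> fst q) (snd q \<otimes> b))"
      using ab(3) by simp
    have big: "s - e / 2 \<le> K (a \<otimes> i) (j \<otimes> b)" if ij: "i \<in> set xs" "j \<in> set xs" for i j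
    proof -
      have "(s + d) - real (length Q) * ((s + d) - (s - d)) \<le> K (a \<otimes> fst (i, j)) (snd (i, j) \<otimes> b)"
      proof (rule avg_concentration[OF _ gt])
        show "K (a \<otimes> fst q) (snd q \<otimes> b) \<le> s + d" if "q \<in> set Q" for q
          unfolding K_def using QG[OF that] ab(1,2) by (intro Pb) simp_all
        show "(i, j) \<in> set Q" using ij by (simp add: Q_def)
      qed
      then show ?thesis using d unfolding N_def by simp
    qed
    have "averaging_list G f s e P"
    proof (rule averaging_listI[OF P])
      fix a' b' assume ab': "a' \<in> carrier G" "b' \<in> carrier G"
      \<comment> \<open>The arbitrary pair (a', b') is reached from the base point as (a g, g' b).
        Passing to the net points of \<open>g\<close> and \<open>g'\<close> costs \<open>e/4\<close>
        each, in addition to the \<open>e/2\<close> of \<open>big\<close>.\<close>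
      define g where "g = inv a \<otimes> a'"
      define g' where "g' = b' \<otimes> inv b"
      have g: "g \<in> carrier G" "g' \<in> carrier G"
        using ab ab' by (simp_all add: g_def g'_def)
      have "a \<otimes> g = a'"
        using ab ab' by (simp add: g_def m_assoc[symmetric])
      have "g' \<otimes> b = b'"
        using ab ab' by (simp add: g'_def m_assoc)
      have "dist (K a' b') (K (a \<otimes> r g) b') \<le> e/4"
        unfolding K_def
      proof (rule avg_dist_le[OF P(1)])
        fix p assume "p \<in> set P"
        then have p: "p \<in> carrier G" by (rule PG)
        then have "a' \<otimes> p \<otimes> b' = a \<otimes> g \<otimes> (p \<otimes> b')" "a \<otimes> r g \<otimes> p \<otimes> b' = a \<otimes> r g \<otimes> (p \<otimes> b')"
          unfolding \<open>a \<otimes> g = a'\<close> using ab ab' rG[OF g(1)] by (simp_all add: m_assoc)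
        then show "dist (f (a' \<otimes> p \<otimes> b')) (f (a \<otimes> r g \<otimes> p \<otimes> b')) \<le> e/4"
          using rb[OF g(1) ab(1), of "p \<otimes> b'"] p ab' by (simp only: m_closed)
      qed
      moreover have "dist (K (a \<otimes> r g) b') (K (a \<otimes> r g) (r g' \<otimes> b)) \<le> e/4"
        unfolding K_def
      proof (rule avg_dist_le[OF P(1)])
        fix p assume "p \<in> set P"
        then have p: "p \<in> carrier G" by (rule PG)
        then have "a \<otimes> r g \<otimes> p \<otimes> b' = a \<otimes> r g \<otimes> p \<otimes> g' \<otimes> b"
            "a \<otimes> r g \<otimes> p \<otimes> (r g' \<otimes> b) = a \<otimes> r g \<otimes> p \<otimes> r g' \<otimes> b"
          unfolding \<open>g' \<otimes> b = b'\<close>[symmetric] using ab g rG[OF g(1)] rG[OF g(2)] by (simp_all add: m_assoc)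
        then show "dist (f (a \<otimes> r g \<otimes> p \<otimes> b')) (f (a \<otimes> r g \<otimes> p \<otimes> (r g' \<otimes> b))) \<le> e/4"
          using rb[OF g(2) _ ab(2), of "a \<otimes> r g \<otimes> p"] p ab(1) rG[OF g(1)] by (simp only: m_closed)
      qed
      moreover have "K a' b' \<le> s + d"
        unfolding K_def by (rule Pb[OF ab'])
      moreover have "s - e / 2 \<le> K (a \<otimes> r g) (r g' \<otimes> b)"
        using g by (intro big) (simp_all add: xs)
      ultimately have "\<bar>K a' b' - s\<bar> \<le> e"
        using d(2) unfolding dist_real_def by linarith
      then show "dist (avg P (\<lambda>p. f (a' \<otimes> p \<otimes> b'))) s \<le> e"
        by (simp add: K_def dist_real_def)
    qed
    then show "\<exists>P. averaging_list G f s e P" ..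
  qed
  then show ?thesis ..
qed

lemma has_mean_exists:
  fixes f :: "'a \<Rightarrow> complex"
  assumes f: "finite_nets G f"
  shows "\<exists>c. has_mean G f c"
proof -
  obtain r where r: "has_mean G (\<lambda>h. Re (f h)) r"
    using has_mean_exists_real finite_nets_linear[OF bounded_linear_Re f] by blast
  obtain i where i: "has_mean G (\<lambda>h. Im (f h)) i"
    using has_mean_exists_real finite_nets_linear[OF bounded_linear_Im f] by blast
  have "has_mean G (\<lambda>h. complex_of_real (Re (f h)) + \<i> * complex_of_real (Im (f h)))
      (complex_of_real r + \<i> * complex_of_real i)"
    by (rule has_mean_add[OF has_mean_linear[OF bounded_linear_of_real r]
          has_mean_linear[OF bounded_linear_mult_right has_mean_linear[OF bounded_linear_of_real i]]])
  then have "has_mean G f (complex_of_real r + \<i> * complex_of_real i)"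
    by (simp flip: complex_eq)
  then show ?thesis ..
qed

end

section \<open>Almost periodic functions and their invariant mean\<close>

lemma translate_apply: "h \<in> carrier G \<Longrightarrow> translate G g f h = f (h \<otimes>\<^bsub>G\<^esub> g)"
  by (simp add: translate_def)

lemma funspace_complex_iff:
  "f \<in> mspace (funspace C (euclidean_metric :: complex metric)) \<longleftrightarrow> f \<in> extensional C \<and> bounded (f ` C)"
  by (simp add: Met_TC.fspace_def)

lemma funspace_dist_le:
  assumes "f \<in> mspace (funspace C (euclidean_metric :: complex metric))"
    "k \<in> mspace (funspace C euclidean_metric)" "0 \<le> e" "\<And>x. x \<in> C \<Longrightarrow> dist (f x) (k x) \<le> e"
  shows "mdist (funspace C euclidean_metric) f k \<le> e"
  using assms by (auto simp: Met_TC.fdist_def intro!: cSUP_least)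

lemma dist_le_funspace:
  assumes "f \<in> mspace (funspace C (euclidean_metric :: complex metric))"
    "k \<in> mspace (funspace C euclidean_metric)" "x \<in> C"
  shows "dist (f x) (k x) \<le> mdist (funspace C euclidean_metric) f k"
proof -
  have "C \<noteq> {}" using assms(3) by blast
  have fk: "f \<in> Met_TC.fspace C" "k \<in> Met_TC.fspace C"
    using assms(1,2) by simp_all
  have "dist (f x) (k x) \<le> (SUP x\<in>C. dist (f x) (k x))"
    using Met_TC.bdd_above_dist[OF fk \<open>C \<noteq> {}\<close>] assms(3) by (rule cSUP_upper2[OF _ _ order_refl])
  then show ?thesis
    using fk \<open>C \<noteq> {}\<close> by (simp add: Met_TC.fdist_def)
qed

context group
begin

lemma translate_in_funspace:
  assumes "f \<in> mspace (funspace (carrier G) (euclidean_metric :: complex metric))" "g \<in> carrier G"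
  shows "translate G g f \<in> mspace (funspace (carrier G) euclidean_metric)"
proof -
  have "bounded (f ` carrier G)"
    using assms(1) by (simp only: funspace_complex_iff)
  moreover have "translate G g f ` carrier G \<subseteq> f ` carrier G"
    using assms(2) by (auto simp: translate_apply)
  ultimately show ?thesis
    unfolding funspace_complex_iff by (auto simp: translate_def intro: bounded_subset)
qed

lemma almost_periodic_unfold:
  "f \<in> almost_periodic G \<longleftrightarrow> f \<in> mspace (funspace (carrier G) euclidean_metric) \<and>
    Metric_space.mtotally_bounded (mspace (funspace (carrier G) euclidean_metric))
      (mdist (funspace (carrier G) euclidean_metric)) ((\<lambda>g. translate G g f) ` carrier G)"
  unfolding almost_periodic_def Let_def by (rule mem_Collect_eq[THEN trans[rotated]]) simp

text \<open>The colour of \<open>g\<close> is the centre of a ball of radius \<open>e/2\<close>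
  containing its translate; equal colours give translates within \<open>e\<close> of each
  other.\<close>

lemma almost_periodic_imp_finite_nets:
  assumes f: "f \<in> almost_periodic G"
  shows "finite_nets G f"
proof (rule finite_netsI)
  let ?B = "funspace (carrier G) (euclidean_metric :: complex metric)"
  interpret B: Metric_space "mspace ?B" "mdist ?B"
    by (rule Metric_space_mspace_mdist)
  have fB: "f \<in> mspace ?B" and tb: "B.mtotally_bounded ((\<lambda>g. translate G g f) ` carrier G)"
    using iffD1[OF almost_periodic_unfold f] by (rule conjunct1, rule conjunct2)
  fix e :: real assume "e > 0"
  then have "e / 2 > 0" by simp
  from tb[unfolded B.mtotally_bounded_def, rule_format, OF this]
  obtain K where K: "finite K" "K \<subseteq> (\<lambda>g. translate G g f) ` carrier G"
    "(\<lambda>g. translate G g f) ` carrier G \<subseteq> (\<Union>k\<in>K. B.mball k (e / 2))"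
    by (elim exE conjE) (rule that)
  have KB: "k \<in> mspace ?B" if k: "k \<in> K" for k
    using subsetD[OF K(2) k] by (rule imageE) (erule ssubst, rule translate_in_funspace[OF fB])
  have "\<forall>g\<in>carrier G. \<exists>k. k \<in> K \<and> mdist ?B k (translate G g f) < e / 2"
  proof
    fix g assume "g \<in> carrier G"
    then have "translate G g f \<in> (\<Union>k\<in>K. B.mball k (e / 2))"
      by (intro subsetD[OF K(3)] imageI)
    then obtain k where k: "k \<in> K" "translate G g f \<in> B.mball k (e / 2)"
      by (rule UN_E)
    show "\<exists>k. k \<in> K \<and> mdist ?B k (translate G g f) < e / 2"
      using k(2) unfolding B.in_mball by (intro exI[of _ k] conjI k(1)) (elim conjE)
  qed
  from bchoice[OF this] obtain c where c: "\<forall>g\<in>carrier G. c g \<in> K \<and> mdist ?B (c g) (translate G g f) < e / 2" ..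
  have close: "dist (c g h) (f (h \<otimes> g)) \<le> e / 2" if gh: "g \<in> carrier G" "h \<in> carrier G" for g h
  proof -
    note cg = bspec[OF c gh(1)]
    have "dist (c g h) (translate G g f h) \<le> mdist ?B (c g) (translate G g f)"
      by (rule dist_le_funspace[OF KB[OF conjunct1[OF cg]] translate_in_funspace[OF fB gh(1)] gh(2)])
    then show ?thesis
      using conjunct2[OF cg] unfolding translate_apply[OF gh(2)] by linarith
  qed
  show "\<exists>s. net_map G f e s"
  proof (rule ex_net_map[where c = c])
    have "c ` carrier G \<subseteq> K"
      using c by (intro image_subsetI) simp
    then show "finite (c ` carrier G)"
      by (rule finite_subset) (rule K(1))
    fix g g' h assume g: "g \<in> carrier G" "g' \<in> carrier G" "c g = c g'" "h \<in> carrier G"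
    show "dist (f (h \<otimes> g)) (f (h \<otimes> g')) \<le> e"
      using close[OF g(1,4)] close[OF g(2,4)] dist_triangle3[of "f (h \<otimes> g)" "f (h \<otimes> g')" "c g h"]
      unfolding g(3) by linarith
  qed
qed

lemma finite_nets_imp_almost_periodic:
  fixes f :: "'a \<Rightarrow> complex"
  assumes ext: "f \<in> extensional (carrier G)" and f: "finite_nets G f"
  shows "f \<in> almost_periodic G"
proof -
  let ?B = "funspace (carrier G) (euclidean_metric :: complex metric)"
  interpret B: Metric_space "mspace ?B" "mdist ?B"
    by (rule Metric_space_mspace_mdist)
  have "bounded (f ` carrier G)"
    using finite_nets_bounded[OF f] unfolding bounded_iff by simp
  then have fB: "f \<in> mspace ?B"
    using ext unfolding funspace_complex_iff by (intro conjI)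
  have "B.mtotally_bounded ((\<lambda>g. translate G g f) ` carrier G)"
    unfolding B.mtotally_bounded_def
  proof (intro allI impI)
    fix e :: real assume e: "e > 0"
    \<comment> \<open>Half of \<open>e\<close>, because the supremum of the distances obeys a
      non-strict bound while the balls are open.\<close>
    then obtain s where "net_map G f (e / 2) s"
      using finite_netsD[OF f, of "e / 2"] by auto
    note s = net_mapD[OF this]
    let ?K = "(\<lambda>g. translate G g f) ` s ` carrier G"
    have "finite ?K"
      using s(1) by (rule finite_imageI)
    moreover have "?K \<subseteq> (\<lambda>g. translate G g f) ` carrier G"
      using s(2) by (intro image_mono image_subsetI)
    moreover have "(\<lambda>g. translate G g f) ` carrier G \<subseteq> (\<Union>k\<in>?K. B.mball k e)"
    proof (rule image_subsetI)
      fix g assume g: "g \<in> carrier G"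
      note t = translate_in_funspace[OF fB s(2)[OF g]] translate_in_funspace[OF fB g]
      have "dist (translate G (s g) f h) (translate G g f h) \<le> e / 2" if h: "h \<in> carrier G" for h
        using s(3)[OF g h] unfolding translate_apply[OF h] by (simp add: dist_commute)
      then have "mdist ?B (translate G (s g) f) (translate G g f) \<le> e / 2"
        using e by (intro funspace_dist_le[OF t]) simp_all
      then have "mdist ?B (translate G (s g) f) (translate G g f) < e"
        using e by linarith
      then have "translate G g f \<in> B.mball (translate G (s g) f) e"
        unfolding B.in_mball by (intro conjI t)
      then show "translate G g f \<in> (\<Union>k\<in>?K. B.mball k e)"
        by (intro UN_I[OF imageI[OF imageI[OF g]]])
    qed
    ultimately show "\<exists>K. finite K \<and> K \<subseteq> (\<lambda>g. translate G g f) ` carrier G \<and>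
        (\<lambda>g. translate G g f) ` carrier G \<subseteq> (\<Union>x\<in>K. B.mball x e)"
      by (intro exI[of _ ?K] conjI)
  qed
  then show ?thesis
    unfolding almost_periodic_unfold by (intro conjI fB)
qed

lemma almost_periodic_iff:
  "f \<in> almost_periodic G \<longleftrightarrow> f \<in> extensional (carrier G) \<and> finite_nets G f"
proof
  assume f: "f \<in> almost_periodic G"
  have "f \<in> mspace (funspace (carrier G) euclidean_metric)"
    by (rule conjunct1[OF iffD1[OF almost_periodic_unfold f]])
  then show "f \<in> extensional (carrier G) \<and> finite_nets G f"
    unfolding funspace_complex_iff using almost_periodic_imp_finite_nets[OF f] by (elim conjE) (intro conjI)
next
  assume "f \<in> extensional (carrier G) \<and> finite_nets G f"
  then show "f \<in> almost_periodic G"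
    by (elim conjE) (rule finite_nets_imp_almost_periodic)
qed

lemma almost_periodicI: "finite_nets G f \<Longrightarrow> (\<lambda>h\<in>carrier G. f h) \<in> almost_periodic G"
  by (auto simp: almost_periodic_iff intro: finite_nets_cong)

lemma almost_periodic_combination:
  assumes "f \<in> almost_periodic G" "k \<in> almost_periodic G"
  shows "(\<lambda>h\<in>carrier G. a * f h + b * k h) \<in> almost_periodic G"
  using assms finite_nets_add[OF finite_nets_linear[OF bounded_linear_mult_right[of a], of f]
      finite_nets_linear[OF bounded_linear_mult_right[of b], of k]]
  by (intro almost_periodicI) (simp add: almost_periodic_iff)

lemma almost_periodic_translate:
  assumes "f \<in> almost_periodic G" "g \<in> carrier G"
  shows "translate G g f \<in> almost_periodic G"
  using assms finite_nets_translate[of f g] unfolding translate_def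
  by (intro almost_periodicI) (simp add: almost_periodic_iff)

lemma has_mean_combination:
  fixes f k :: "'a \<Rightarrow> complex"
  assumes "has_mean G f c" "has_mean G k d"
  shows "has_mean G (\<lambda>h\<in>carrier G. a * f h + b * k h) (a * c + b * d)"
  by (rule has_mean_cong[OF has_mean_add[OF has_mean_linear[OF bounded_linear_mult_right assms(1)]
          has_mean_linear[OF bounded_linear_mult_right assms(2)]]]) simp

lemma the_has_mean: "has_mean G f c \<Longrightarrow> (THE c. has_mean G f c) = c"
  using has_mean_unique by blast

lemma has_mean_in_nonneg_Reals:
  fixes f :: "'a \<Rightarrow> complex"
  assumes f: "has_mean G f c" and nn: "\<And>h. h \<in> carrier G \<Longrightarrow> f h \<in> \<real>\<^sub>\<ge>\<^sub>0"
  shows "c \<in> \<real>\<^sub>\<ge>\<^sub>0"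
proof -
  have "0 \<le> Re c"
    using has_mean_nonneg[OF has_mean_linear[OF bounded_linear_Re f]] nn by (simp add: complex_nonneg_Reals_iff)
  moreover have "has_mean G (\<lambda>_. 0) (Im c)"
    using has_mean_cong[OF has_mean_linear[OF bounded_linear_Im f], of "\<lambda>_. 0"] nn
    by (simp add: complex_nonneg_Reals_iff)
  then have "Im c = 0"
    using has_mean_unique has_mean_const by blast
  ultimately show ?thesis
    by (simp add: complex_nonneg_Reals_iff)
qed

text \<open>\<open>ap_mean\<close> is a definite description, so it can be evaluated only once an
  invariant mean is known to exist and to be unique.\<close>

lemma invariant_mean_exists: "invariant_mean G (\<lambda>f\<in>almost_periodic G. THE c. has_mean G f c)"
  (is "invariant_mean G ?M")
proof -
  have M: "?M f = c" if "f \<in> almost_periodic G" "has_mean G f c" for f c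
    using that the_has_mean by simp
  have ex: "\<exists>c. has_mean G f c" if "f \<in> almost_periodic G" for f
    using that has_mean_exists by (simp add: almost_periodic_iff)
  show ?thesis
    unfolding invariant_mean_def
  proof (intro conjI ballI allI impI)
    show "?M \<in> extensional (almost_periodic G)"
      by simp
  next
    fix f k a b assume fk: "f \<in> almost_periodic G" "k \<in> almost_periodic G"
    obtain c d where cd: "has_mean G f c" "has_mean G k d"
      using ex fk by blast
    show "?M (\<lambda>h\<in>carrier G. a * f h + b * k h) = a * ?M f + b * ?M k"
      unfolding M[OF fk(1) cd(1)] M[OF fk(2) cd(2)]
      by (rule M[OF almost_periodic_combination[OF fk] has_mean_combination[OF cd]])
  next
    fix f assume f: "f \<in> almost_periodic G" "\<forall>h\<in>carrier G. f h \<in> \<real>\<^sub>\<ge>\<^sub>0"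
    obtain c where c: "has_mean G f c"
      using ex f by blast
    show "?M f \<in> \<real>\<^sub>\<ge>\<^sub>0"
      unfolding M[OF f(1) c] using has_mean_in_nonneg_Reals[OF c] f(2) by blast
  next
    have "has_mean G (\<lambda>h\<in>carrier G. 1 :: complex) 1"
      by (rule has_mean_cong[OF has_mean_const]) simp
    then show "?M (\<lambda>h\<in>carrier G. 1) = 1"
      by (intro M almost_periodicI finite_nets_const)
  next
    fix f g assume f: "f \<in> almost_periodic G" and g: "g \<in> carrier G"
    obtain c where c: "has_mean G f c"
      using ex f by blast
    have "has_mean G (translate G g f) c"
      by (rule has_mean_cong[OF has_mean_translate[OF c one_closed g]]) (simp add: translate_apply)
    then show "?M (translate G g f) = ?M f"
      unfolding M[OF f c] by (rule M[OF almost_periodic_translate[OF f g]])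
  qed
qed

section \<open>Every invariant mean takes the mean value\<close>

context
  fixes M assumes M: "invariant_mean G M"
begin

lemma invariant_mean_linear:
  "f \<in> almost_periodic G \<Longrightarrow> k \<in> almost_periodic G \<Longrightarrow> M (\<lambda>h\<in>carrier G. a * f h + b * k h) = a * M f + b * M k"
  using M unfolding invariant_mean_def by blast

lemma invariant_mean_nonneg:
  "f \<in> almost_periodic G \<Longrightarrow> (\<And>h. h \<in> carrier G \<Longrightarrow> f h \<in> \<real>\<^sub>\<ge>\<^sub>0) \<Longrightarrow> M f \<in> \<real>\<^sub>\<ge>\<^sub>0"
  using M unfolding invariant_mean_def by blast

lemma invariant_mean_one: "M (\<lambda>h\<in>carrier G. 1) = 1"
  using M unfolding invariant_mean_def by blast

lemma invariant_mean_translate: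
  "f \<in> almost_periodic G \<Longrightarrow> g \<in> carrier G \<Longrightarrow> M (translate G g f) = M f"
  using M unfolding invariant_mean_def by blast

text \<open>An average of right translates has the same mean as \<open>f\<close>; this is where
  translation invariance enters.\<close>

lemma invariant_mean_avg:
  assumes f: "f \<in> almost_periodic G" and P: "set P \<subseteq> carrier G" "P \<noteq> []"
  shows "(\<lambda>h\<in>carrier G. avg P (\<lambda>p. f (h \<otimes> p))) \<in> almost_periodic G"
    and "M (\<lambda>h\<in>carrier G. avg P (\<lambda>p. f (h \<otimes> p))) = M f"
proof -
  define S where "S P = (\<lambda>h\<in>carrier G. \<Sum>p\<leftarrow>P. f (h \<otimes> p))" for P
  have SP: "S P \<in> almost_periodic G \<and> M (S P) = of_nat (length P) * M f"
    using P(1)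
  proof (induction P)
    case Nil
    \<comment> \<open>Linearity is available for combinations of two almost periodic functions, so
      the zero function is written as one.\<close>
    have eq: "S [] = (\<lambda>h\<in>carrier G. 0 * f h + 0 * f h)"
      by (simp add: S_def)
    have "S [] \<in> almost_periodic G"
      unfolding eq by (rule almost_periodic_combination[OF f f])
    moreover have "M (S []) = 0 * M f + 0 * M f"
      unfolding eq by (rule invariant_mean_linear[OF f f])
    ultimately show ?case
      by (simp only: list.size mult_zero_left of_nat_0 add_0_right simp_thms)
  next
    case (Cons p P)
    have p: "p \<in> carrier G" using Cons.prems by simp
    have IH: "S P \<in> almost_periodic G" "M (S P) = of_nat (length P) * M f"
      using Cons by simp_all
    have eq: "S (p # P) = (\<lambda>h\<in>carrier G. 1 * translate G p f h + 1 * S P h)"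
      unfolding S_def by (rule restrict_ext) (simp add: translate_apply)
    note t = almost_periodic_translate[OF f p]
    have "S (p # P) \<in> almost_periodic G"
      unfolding eq by (rule almost_periodic_combination[OF t IH(1)])
    moreover have "M (S (p # P)) = 1 * M (translate G p f) + 1 * M (S P)"
      unfolding eq by (rule invariant_mean_linear[OF t IH(1)])
    ultimately show ?case
      using invariant_mean_translate[OF f p] IH(2) by (simp add: algebra_simps)
  qed
  have eq: "(\<lambda>h\<in>carrier G. avg P (\<lambda>p. f (h \<otimes> p))) =
      (\<lambda>h\<in>carrier G. inverse (of_nat (length P)) * S P h + 0 * f h)"
    unfolding S_def by (rule restrict_ext) (simp add: avg_def scaleR_conv_of_real)
  note SP1 = conjunct1[OF SP] and SP2 = conjunct2[OF SP]
  show "(\<lambda>h\<in>carrier G. avg P (\<lambda>p. f (h \<otimes> p))) \<in> almost_periodic G"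
    unfolding eq by (rule almost_periodic_combination[OF SP1 f])
  have "M (\<lambda>h\<in>carrier G. avg P (\<lambda>p. f (h \<otimes> p))) = inverse (of_nat (length P)) * M (S P) + 0 * M f"
    unfolding eq by (rule invariant_mean_linear[OF SP1 f])
  then show "M (\<lambda>h\<in>carrier G. avg P (\<lambda>p. f (h \<otimes> p))) = M f"
    using P(2) by (simp only: SP2) simp
qed

text \<open>Taking h as the left factor and 1 as the right one, the averaged function
  \<open>A\<close> is within \<open>e\<close> of \<open>c\<close> on the whole group. Positivity
  then puts its mean, which is that of \<open>f\<close>, within \<open>e\<close> of
  \<open>c\<close>.\<close>

lemma invariant_mean_eq_real:
  assumes f: "f \<in> almost_periodic G" "\<And>h. h \<in> carrier G \<Longrightarrow> Im (f h) = 0" and c: "has_mean G f c"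
  shows "M f = c"
proof -
  have "has_mean G (\<lambda>_. 0) (Im c)"
    using has_mean_cong[OF has_mean_linear[OF bounded_linear_Im c], of "\<lambda>_. 0"] f(2) by simp
  then have Imc: "Im c = 0"
    using has_mean_unique has_mean_const by blast
  have one: "(\<lambda>h\<in>carrier G. 1) \<in> almost_periodic G"
    by (intro almost_periodicI finite_nets_const)
  have bounds: "Im (M f) = 0 \<and> \<bar>Re (M f) - Re c\<bar> \<le> e" if e: "e > 0" for e
  proof -
    obtain P where "averaging_list G f c e P"
      using has_meanD[OF c e] by blast
    note P = averaging_listD[OF this]
    define A where "A = (\<lambda>h\<in>carrier G. avg P (\<lambda>p. f (h \<otimes> p)))"
    have A: "A \<in> almost_periodic G" "M A = M f"
      unfolding A_def by (rule invariant_mean_avg[OF f(1) P(2,1)])+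
    have Ah: "Im (A h) = 0" "\<bar>Re (A h) - Re c\<bar> \<le> e" if h: "h \<in> carrier G" for h
    proof -
      have "avg P (\<lambda>p. f (h \<otimes> p)) = avg P (\<lambda>p. f (h \<otimes> p \<otimes> \<one>))"
        using P(2) h by (intro avg_cong) (simp add: subset_iff)
      then have "cmod (A h - c) \<le> e"
        using P(3)[OF h one_closed] h by (simp add: A_def dist_norm)
      then show "\<bar>Re (A h) - Re c\<bar> \<le> e"
        using abs_Re_le_cmod[of "A h - c"] by simp
      have "avg P (\<lambda>p. Im (f (h \<otimes> p))) = avg P (\<lambda>_. 0)"
        using P(2) h f(2) by (intro avg_cong) (simp add: subset_iff)
      then show "Im (A h) = 0"
        using P(1) h by (simp add: A_def avg_linear[OF bounded_linear_Im] avg_const)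
    qed
    \<comment> \<open>The function A + (e - c) is real and nonnegative, which gives the lower bound;
      (e + c) - A below gives the upper one.\<close>
    have "M (\<lambda>h\<in>carrier G. 1 * A h + (of_real e - c) * (\<lambda>h\<in>carrier G. 1) h) \<in> \<real>\<^sub>\<ge>\<^sub>0"
      by (rule invariant_mean_nonneg[OF almost_periodic_combination[OF A(1) one]])
        (use Ah Imc in \<open>force simp: complex_nonneg_Reals_iff\<close>)
    then have 1: "M f + (of_real e - c) \<in> \<real>\<^sub>\<ge>\<^sub>0"
      unfolding invariant_mean_linear[OF A(1) one] invariant_mean_one A(2) by simp
    have "M (\<lambda>h\<in>carrier G. (- 1) * A h + (of_real e + c) * (\<lambda>h\<in>carrier G. 1) h) \<in> \<real>\<^sub>\<ge>\<^sub>0"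
      by (rule invariant_mean_nonneg[OF almost_periodic_combination[OF A(1) one]])
        (use Ah Imc in \<open>force simp: complex_nonneg_Reals_iff\<close>)
    then have 2: "- M f + (of_real e + c) \<in> \<real>\<^sub>\<ge>\<^sub>0"
      unfolding invariant_mean_linear[OF A(1) one] invariant_mean_one A(2) by simp
    show ?thesis
      using 1 2 Imc by (simp add: complex_nonneg_Reals_iff abs_le_iff)
  qed
  have "\<bar>Re (M f) - Re c\<bar> \<le> 0 + e" if "e > 0" for e
    using bounds[OF that] by simp
  then have "\<bar>Re (M f) - Re c\<bar> \<le> 0"
    by (rule field_le_epsilon)
  then show ?thesis
    using bounds[OF zero_less_one] Imc by (simp add: complex_eq_iff)
qed

lemma invariant_mean_eq:
  assumes f: "f \<in> almost_periodic G" and c: "has_mean G f c"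
  shows "M f = c"
proof -
  let ?R = "\<lambda>h\<in>carrier G. complex_of_real (Re (f h))" and ?I = "\<lambda>h\<in>carrier G. complex_of_real (Im (f h))"
  have fn: "finite_nets G f" using f by (simp add: almost_periodic_iff)
  have R: "?R \<in> almost_periodic G"
    by (intro almost_periodicI finite_nets_linear[OF bounded_linear_of_real] finite_nets_linear[OF bounded_linear_Re fn])
  have I: "?I \<in> almost_periodic G"
    by (intro almost_periodicI finite_nets_linear[OF bounded_linear_of_real] finite_nets_linear[OF bounded_linear_Im fn])
  have "has_mean G ?R (complex_of_real (Re c))"
    by (rule has_mean_cong[OF has_mean_linear[OF bounded_linear_of_real has_mean_linear[OF bounded_linear_Re c]]]) simp
  then have MR: "M ?R = complex_of_real (Re c)"
    by (intro invariant_mean_eq_real R) simp_all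
  have "has_mean G ?I (complex_of_real (Im c))"
    by (rule has_mean_cong[OF has_mean_linear[OF bounded_linear_of_real has_mean_linear[OF bounded_linear_Im c]]]) simp
  then have MI: "M ?I = complex_of_real (Im c)"
    by (intro invariant_mean_eq_real I) simp_all
  have eq: "f = (\<lambda>h\<in>carrier G. 1 * ?R h + \<i> * ?I h)"
  proof (rule extensionalityI)
    show "f \<in> extensional (carrier G)" using f by (simp add: almost_periodic_iff)
    show "f h = (\<lambda>h\<in>carrier G. 1 * ?R h + \<i> * ?I h) h" if "h \<in> carrier G" for h
      using that complex_eq[of "f h"] by simp
  qed simp
  have "M f = 1 * M ?R + \<i> * M ?I"
    using arg_cong[OF eq, of M] invariant_mean_linear[OF R I, of 1 \<i>] by (rule trans)
  then show ?thesis
    unfolding MR MI using complex_eq[of c] by simp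
qed

end

lemma ap_mean_eq:
  assumes f: "f \<in> almost_periodic G" and c: "has_mean G f c"
  shows "ap_mean G f = c"
proof -
  let ?M = "\<lambda>f\<in>almost_periodic G. THE c. has_mean G f c"
  have uniq: "M = ?M" if M: "invariant_mean G M" for M
  proof (rule extensionalityI)
    show "M \<in> extensional (almost_periodic G)"
      using M unfolding invariant_mean_def by blast
    show "M k = ?M k" if k: "k \<in> almost_periodic G" for k
    proof -
      obtain d where d: "has_mean G k d"
        using k has_mean_exists by (auto simp: almost_periodic_iff)
      show ?thesis
        using invariant_mean_eq[OF M k d] invariant_mean_eq[OF invariant_mean_exists k d] by simp
    qed
  qed simp
  have "ap_mean G = ?M"
    unfolding ap_mean_def by (rule the_equality) (rule invariant_mean_exists, rule uniq)
  then show ?thesis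
    using invariant_mean_eq[OF invariant_mean_exists f c] by simp
qed

end

section \<open>Orbit closures\<close>

lemma continuous_map_avg:
  fixes F :: "'p \<Rightarrow> 'x \<Rightarrow> 'b::real_normed_vector"
  assumes "\<And>p. p \<in> set P \<Longrightarrow> continuous_map X euclidean (F p)"
  shows "continuous_map X euclidean (\<lambda>y. avg P (\<lambda>p. F p y))"
proof -
  have "continuous_map X euclidean (\<lambda>y. \<Sum>p\<leftarrow>P. F p y)"
    using assms by (induction P) (auto intro: continuous_map_add)
  moreover have "continuous_map euclidean euclidean (\<lambda>z::'b. z /\<^sub>R real (length P))"
    by (simp add: continuous_intros)
  ultimately have "continuous_map X euclidean ((\<lambda>z. z /\<^sub>R real (length P)) \<circ> (\<lambda>y. \<Sum>p\<leftarrow>P. F p y))"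
    by (rule continuous_map_compose)
  then show ?thesis
    by (simp add: avg_def o_def)
qed

lemma integral_avg:
  fixes F :: "'p \<Rightarrow> 'x \<Rightarrow> 'b::{banach, second_countable_topology}"
  assumes "\<And>p. p \<in> set P \<Longrightarrow> integrable \<mu> (F p)"
  shows "(\<integral>y. avg P (\<lambda>p. F p y) \<partial>\<mu>) = avg P (\<lambda>p. \<integral>y. F p y \<partial>\<mu>)"
proof -
  have "integrable \<mu> (\<lambda>y. \<Sum>p\<leftarrow>P. F p y) \<and>
      (\<integral>y. (\<Sum>p\<leftarrow>P. F p y) \<partial>\<mu>) = (\<Sum>p\<leftarrow>P. \<integral>y. F p y \<partial>\<mu>)"
    using assms by (induction P) auto
  then show ?thesis
    by (simp add: avg_def)
qed

section \<open>Orbits, and the mean along a finite orbit\<close>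

locale homeo_orbit =
  fixes G (structure) and X :: "'x topology" and act :: "'g \<Rightarrow> 'x \<Rightarrow> 'x" and x :: 'x
  assumes action: "homeo_action G X act" and x: "x \<in> topspace X"
begin

lemma group_action: "group_action G (topspace X) act"
  using action by (simp add: homeo_action_def)

sublocale group G
  using group_action group_action.group_hom group_hom.axioms(1) by blast

lemma act_closed: "g \<in> carrier G \<Longrightarrow> y \<in> topspace X \<Longrightarrow> act g y \<in> topspace X"
  using group_action.element_image[OF group_action] by blast

lemma act_mult: "g \<in> carrier G \<Longrightarrow> h \<in> carrier G \<Longrightarrow> y \<in> topspace X \<Longrightarrow> act (g \<otimes> h) y = act g (act h y)"
  using group_action.composition_rule[OF group_action] by blast

lemma act_one: "y \<in> topspace X \<Longrightarrow> act \<one> y = y"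
  using group_action.id_eq_one[OF group_action] by (metis restrict_apply')

lemma act_inv_act: "g \<in> carrier G \<Longrightarrow> y \<in> topspace X \<Longrightarrow> act (inv g) (act g y) = y"
  using act_mult[of "inv g" g y] act_one by simp

lemma act_act_inv: "g \<in> carrier G \<Longrightarrow> y \<in> topspace X \<Longrightarrow> act g (act (inv g) y) = y"
  using act_mult[of g "inv g" y] act_one by simp

lemma continuous_act: "g \<in> carrier G \<Longrightarrow> continuous_map X X (act g)"
  using action by (simp add: homeo_action_def homeomorphic_imp_continuous_map)

abbreviation \<gamma> :: "'x set" where "\<gamma> \<equiv> orbit G act x"

lemma orbit_eq: "\<gamma> = (\<lambda>g. act g x) ` carrier G"
  by (auto simp: orbit_def)

lemma orbit_subset: "\<gamma> \<subseteq> topspace X"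
  using act_closed x by (auto simp: orbit_eq)

lemma act_orbit: "g \<in> carrier G \<Longrightarrow> y \<in> \<gamma> \<Longrightarrow> act g y \<in> \<gamma>"
  using x by (auto simp: orbit_eq act_mult[symmetric])

lemma act_image_orbit:
  assumes "g \<in> carrier G"
  shows "act g ` \<gamma> = \<gamma>"
proof
  show "act g ` \<gamma> \<subseteq> \<gamma>" using act_orbit[OF assms] by blast
  show "\<gamma> \<subseteq> act g ` \<gamma>"
  proof
    fix y assume y: "y \<in> \<gamma>"
    then have "y = act g (act (inv g) y)"
      using act_act_inv[OF assms] orbit_subset by auto
    then show "y \<in> act g ` \<gamma>"
      using act_orbit[OF inv_closed[OF assms] y] by blast
  qed
qed

lemma ap_mean_orbit_fun:
  assumes "finite_nets G (\<lambda>g. \<phi> (act g x))" "has_mean G (\<lambda>g. \<phi> (act g x)) c"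
  shows "ap_mean G (orbit_fun G act \<phi> x) = c"
  unfolding orbit_fun_def
  by (rule ap_mean_eq[OF almost_periodicI[OF assms(1)]]) (rule has_mean_cong[OF assms(2)], simp)

text \<open>Averages are within \<open>e\<close> of \<open>c\<close> at every orbit point, so their
  sum over the orbit is close to \<open>c\<close> times its size. Each group element permutes the
  orbit, so the averaging does not change that sum.\<close>

lemma ap_mean_finite_orbit:
  fixes \<phi> :: "'x \<Rightarrow> complex"
  assumes fin: "finite \<gamma>"
  shows "ap_mean G (orbit_fun G act \<phi> x) = (\<Sum>y\<in>\<gamma>. \<phi> y) / of_nat (card \<gamma>)"
proof -
  have nets: "finite_nets G (\<lambda>g. \<phi> (act g x))"
  \<comment> \<open>Colouring \<open>g\<close> by the point g x gives distance 0, because the value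
    at h g depends on g x alone.\<close>
  proof (intro finite_netsI ex_net_map[where c = "\<lambda>g. act g x"])
    show "finite ((\<lambda>g. act g x) ` carrier G)"
      using fin by (simp add: orbit_eq)
  qed (use x in \<open>simp add: act_mult\<close>)
  then obtain c where c: "has_mean G (\<lambda>g. \<phi> (act g x)) c"
    using has_mean_exists by blast
  define m where "m = (\<Sum>y\<in>\<gamma>. \<phi> y) / of_nat (card \<gamma>)"
  have "x \<in> \<gamma>"
    using act_one[OF x] one_closed unfolding orbit_eq by force
  then have card: "card \<gamma> > 0"
    using fin card_gt_0_iff by blast
  have "dist m c \<le> 0 + e" if e: "e > 0" for e
  proof -
    obtain P where "averaging_list G (\<lambda>g. \<phi> (act g x)) c e P"
      using has_meanD[OF c e] by blast
    note P = averaging_listD[OF this]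
    have near: "cmod (avg P (\<lambda>p. \<phi> (act p y)) - c) \<le> e" if y: "y \<in> \<gamma>" for y
    proof -
      obtain b where b: "b \<in> carrier G" "y = act b x"
        using y by (auto simp: orbit_eq)
      have "avg P (\<lambda>p. \<phi> (act (\<one> \<otimes> p \<otimes> b) x)) = avg P (\<lambda>p. \<phi> (act p y))"
        using P(2) b x by (intro avg_cong) (simp add: act_mult subset_iff)
      then show ?thesis
        using P(3)[OF one_closed b(1)] by (simp add: dist_norm)
    qed
    have "(\<Sum>y\<in>\<gamma>. avg P (\<lambda>p. \<phi> (act p y))) = avg P (\<lambda>p. \<Sum>y\<in>\<gamma>. \<phi> (act p y))"
      by (simp add: avg_sum)
    also have "\<dots> = avg P (\<lambda>_. \<Sum>y\<in>\<gamma>. \<phi> y)"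
    proof (rule avg_cong)
      fix p assume "p \<in> set P"
      then have p: "p \<in> carrier G" using P(2) by blast
      have "inj_on (act p) \<gamma>"
        using orbit_subset act_inv_act[OF p] by (intro inj_on_inverseI[of _ "act (inv p)"]) blast
      then show "(\<Sum>y\<in>\<gamma>. \<phi> (act p y)) = (\<Sum>y\<in>\<gamma>. \<phi> y)"
        using sum.reindex[of "act p" \<gamma> \<phi>] act_image_orbit[OF p] by (simp add: o_def)
    qed
    also have "\<dots> = of_nat (card \<gamma>) * m"
      using card P(1) by (simp add: avg_const m_def)
    finally have "of_nat (card \<gamma>) * (m - c) = (\<Sum>y\<in>\<gamma>. avg P (\<lambda>p. \<phi> (act p y)) - c)"
      by (simp add: sum_subtractf algebra_simps)
    then have "real (card \<gamma>) * cmod (m - c) = cmod (\<Sum>y\<in>\<gamma>. avg P (\<lambda>p. \<phi> (act p y)) - c)"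
      by (metis norm_mult norm_of_nat)
    also have "\<dots> \<le> real (card \<gamma>) * e"
      by (rule sum_norm_bound[OF near])
    finally show ?thesis
      using card by (simp add: dist_norm)
  qed
  then have "dist m c \<le> 0" by (rule field_le_epsilon)
  then show ?thesis
    using ap_mean_orbit_fun[OF nets c] by (simp add: m_def)
qed

end

section \<open>The closure of an orbit and its invariant measures\<close>

locale compact_orbit = homeo_orbit G X act x
  for G (structure) and X :: "'x topology" and act :: "'g \<Rightarrow> 'x \<Rightarrow> 'x" and x :: 'x +
  assumes compact: "compact_space X" and Hausdorff: "Hausdorff_space X"
begin

abbreviation K :: "'x set" where "K \<equiv> X closure_of \<gamma>"

abbreviation T :: "'x topology" where "T \<equiv> subtopology X K"

lemma K_subset: "K \<subseteq> topspace X"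
  by (rule closure_of_subset_topspace)

lemma topspace_Int_K [simp]: "topspace X \<inter> K = K"
  using K_subset by blast

lemma orbit_subset_K: "\<gamma> \<subseteq> K"
  by (rule closure_of_subset[OF orbit_subset])

lemma x_in_K: "x \<in> K"
  using act_one[OF x] one_closed orbit_subset_K unfolding orbit_eq by force

lemma compactin_K: "compactin X K"
  using compact by (simp add: closedin_compact_space)

lemma compact_T: "compact_space T"
  by (rule compact_space_subtopology[OF compactin_K])

lemma Hausdorff_T: "Hausdorff_space T"
  by (rule Hausdorff_space_subtopology[OF Hausdorff])

lemma act_K:
  assumes "g \<in> carrier G" "y \<in> K"
  shows "act g y \<in> K"
  using continuous_map_image_closure_subset[OF continuous_act[OF assms(1)], of \<gamma>] assms
  by (auto simp: act_image_orbit)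

lemma continuous_act_T:
  assumes "g \<in> carrier G"
  shows "continuous_map T T (act g)"
  using continuous_map_from_subtopology[OF continuous_act[OF assms]] act_K[OF assms]
  by (auto simp: continuous_map_in_subtopology)

lemma continuous_comp_act:
  assumes "g \<in> carrier G" "continuous_map T euclidean \<phi>"
  shows "continuous_map T euclidean (\<lambda>y. \<phi> (act g y))"
  using continuous_map_compose[OF continuous_act_T[OF assms(1)] assms(2)] by (simp add: o_def)

lemma closed_dense:
  assumes "closedin T C" "\<gamma> \<subseteq> C"
  shows "C = K"
proof
  show "C \<subseteq> K"
    using closedin_subset[OF assms(1)] by simp
  have "closedin X C"
    using assms(1) closedin_closed_subtopology[of X K] by simp
  then show "K \<subseteq> C"
    using assms(2) by (rule closure_of_minimal[rotated])
qed

text \<open>\<open>invariant_measure\<close> speaks of images while measurability and push-forward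
  speak of preimages; the inverse element translates between them.\<close>

lemma act_image_eq_vimage:
  assumes "g \<in> carrier G" "A \<subseteq> K"
  shows "act g ` A = act (inv g) -` A \<inter> K"
proof
  show "act g ` A \<subseteq> act (inv g) -` A \<inter> K"
    using assms act_K K_subset by (auto simp: act_inv_act subset_iff)
  show "act (inv g) -` A \<inter> K \<subseteq> act g ` A"
  proof
    fix y assume y: "y \<in> act (inv g) -` A \<inter> K"
    then have "y = act g (act (inv g) y)"
      using act_act_inv[OF assms(1)] K_subset by auto
    then show "y \<in> act g ` A" using y by blast
  qed
qed

lemma act_measurable:
  assumes \<mu>: "regular_borel_measure T \<mu>" and g: "g \<in> carrier G"
  shows "act g \<in> measurable \<mu> \<mu>"
proof (rule measurable_sigma_sets[where A = "{U. openin T U}" and \<Omega> = "topspace T"])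
  show "sets \<mu> = sigma_sets (topspace T) {U. openin T U}"
    by (rule regular_borelD(2)[OF \<mu>])
  show "{U. openin T U} \<subseteq> Pow (topspace T)"
    using openin_subset[of T] by blast
  show "act g \<in> space \<mu> \<rightarrow> topspace T"
    using act_K[OF g] regular_borelD(1)[OF \<mu>] by auto
  fix U assume "U \<in> {U. openin T U}"
  then have "openin T {y \<in> topspace T. act g y \<in> U}"
    by (intro openin_continuous_map_preimage[OF continuous_act_T[OF g]]) simp
  moreover have "{y \<in> topspace T. act g y \<in> U} = act g -` U \<inter> space \<mu>"
    using regular_borelD(1)[OF \<mu>] by auto
  ultimately show "act g -` U \<inter> space \<mu> \<in> sets \<mu>"
    using regular_borelD(3)[OF \<mu>] by metis
qed

lemma act_image_sets:
  assumes \<mu>: "regular_borel_measure T \<mu>" and g: "g \<in> carrier G" and A: "A \<in> sets \<mu>"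
  shows "act g ` A \<in> sets \<mu>"
proof -
  have "A \<subseteq> K"
    using sets.sets_into_space[OF A] regular_borelD(1)[OF \<mu>] by simp
  then show ?thesis
    using measurable_sets[OF act_measurable[OF \<mu> inv_closed[OF g]] A] regular_borelD(1)[OF \<mu>]
    by (simp add: act_image_eq_vimage[OF g])
qed

text \<open>Invariance identifies the push-forward of \<open>\<mu>\<close> under
  \<open>act g\<close> with \<open>\<mu>\<close>, since a preimage under g is an image under its
  inverse.\<close>

lemma integral_act:
  fixes \<phi> :: "'x \<Rightarrow> 'b::{banach, second_countable_topology}"
  assumes \<mu>: "regular_borel_measure T \<mu>" and inv: "invariant_measure G act \<mu>"
    and g: "g \<in> carrier G" and \<phi>: "continuous_map T euclidean \<phi>"
  shows "(\<integral>y. \<phi> (act g y) \<partial>\<mu>) = (\<integral>y. \<phi> y \<partial>\<mu>)"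
proof -
  have "distr \<mu> \<mu> (act g) = \<mu>"
  proof (rule measure_eqI)
    fix A assume "A \<in> sets (distr \<mu> \<mu> (act g))"
    then have A: "A \<in> sets \<mu>" by simp
    then have "A \<subseteq> K"
      using sets.sets_into_space[OF A] regular_borelD(1)[OF \<mu>] by simp
    then have "act g -` A \<inter> space \<mu> = act (inv g) ` A"
      using act_image_eq_vimage[OF inv_closed[OF g]] g regular_borelD(1)[OF \<mu>] by simp
    then have "emeasure (distr \<mu> \<mu> (act g)) A = emeasure \<mu> (act (inv g) ` A)"
      by (simp add: emeasure_distr[OF act_measurable[OF \<mu> g] A])
    also have "\<dots> = emeasure \<mu> A"
      using inv A inv_closed[OF g] unfolding invariant_measure_def by blast
    finally show "emeasure (distr \<mu> \<mu> (act g)) A = emeasure \<mu> A" .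
  qed simp
  then show ?thesis
    using integral_distr[OF act_measurable[OF \<mu> g] regular_borel_measurable[OF \<mu> \<phi>]] by simp
qed

text \<open>Averages of \<open>\<phi>\<close> over the group that are almost constant on the orbit are almost constant on its
  closure, while integration against an invariant measure does not see the averaging.\<close>

lemma integral_eq_mean:
  fixes \<phi> :: "'x \<Rightarrow> 'b::{banach, second_countable_topology}"
  assumes \<mu>: "invariant_regular_prob G act T \<mu>" and \<phi>: "continuous_map T euclidean \<phi>"
    and c: "has_mean G (\<lambda>g. \<phi> (act g x)) c"
  shows "(\<integral>y. \<phi> y \<partial>\<mu>) = c"
proof -
  have reg: "regular_borel_measure T \<mu>" and inv: "invariant_measure G act \<mu>" and one: "emeasure \<mu> K = 1"
    using \<mu> by (simp_all add: invariant_regular_prob_def)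
  interpret finite_measure \<mu> by (rule regular_borel_finite[OF compact_T reg])
  have space: "space \<mu> = K" using regular_borelD(1)[OF reg] by simp
  have mK: "measure \<mu> K = 1" using one by (simp add: measure_def)
  have "dist (\<integral>y. \<phi> y \<partial>\<mu>) c \<le> 0 + e" if e: "e > 0" for e
  proof -
    obtain P where "averaging_list G (\<lambda>g. \<phi> (act g x)) c e P"
      using has_meanD[OF c e] by blast
    note P = averaging_listD[OF this]
    define F where "F y = avg P (\<lambda>p. \<phi> (act p y))" for y
    have cont: "continuous_map T euclidean (\<lambda>y. \<phi> (act p y))" if "p \<in> set P" for p
      using that P(2) by (intro continuous_comp_act[OF _ \<phi>]) blast
    have F: "continuous_map T euclidean F"
      unfolding F_def by (rule continuous_map_avg[OF cont])
    have "{y \<in> topspace T. F y \<in> cball c e} = K"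
    proof (rule closed_dense)
      show "closedin T {y \<in> topspace T. F y \<in> cball c e}"
        using F by (rule closedin_continuous_map_preimage) simp
      show "\<gamma> \<subseteq> {y \<in> topspace T. F y \<in> cball c e}"
      proof
        fix y assume y: "y \<in> \<gamma>"
        then obtain b where b: "b \<in> carrier G" "y = act b x"
          by (auto simp: orbit_eq)
        have "avg P (\<lambda>p. \<phi> (act (\<one> \<otimes> p \<otimes> b) x)) = F y"
          unfolding F_def using P(2) b x by (intro avg_cong) (simp add: act_mult subset_iff)
        then show "y \<in> {y \<in> topspace T. F y \<in> cball c e}"
          using P(3)[OF one_closed b(1)] y orbit_subset_K by (auto simp: dist_commute)
      qed
    qed
    then have near: "norm (F y - c) \<le> e" if "y \<in> K" for y
      using that by (force simp: dist_norm norm_minus_commute)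
    have intF: "integrable \<mu> F"
      by (rule regular_borel_integrable[OF compact_T reg F])
    have "(\<integral>y. F y \<partial>\<mu>) = avg P (\<lambda>p. \<integral>y. \<phi> (act p y) \<partial>\<mu>)"
      unfolding F_def by (rule integral_avg[OF regular_borel_integrable[OF compact_T reg cont]])
    also have "\<dots> = avg P (\<lambda>_. \<integral>y. \<phi> y \<partial>\<mu>)"
      using P(2) by (intro avg_cong integral_act[OF reg inv _ \<phi>]) blast
    also have "\<dots> = (\<integral>y. \<phi> y \<partial>\<mu>)"
      by (rule avg_const[OF P(1)])
    finally have "(\<integral>y. \<phi> y \<partial>\<mu>) - c = (\<integral>y. F y - c \<partial>\<mu>)"
      using intF by (simp add: space mK)
    also have "norm \<dots> \<le> (\<integral>y. norm (F y - c) \<partial>\<mu>)"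
      by (rule integral_norm_bound)
    also have "\<dots> \<le> (\<integral>y. e \<partial>\<mu>)"
      using intF near by (intro integral_mono) (auto simp: space)
    also have "\<dots> = e"
      by (simp add: space mK)
    finally show ?thesis
      by (simp add: dist_norm)
  qed
  then have "dist (\<integral>y. \<phi> y \<partial>\<mu>) c \<le> 0" by (rule field_le_epsilon)
  then show ?thesis by simp
qed

text \<open>Adding the complement of \<open>K \<times> K\<close> turns a neighbourhood of the diagonal of \<open>K\<close> into one of the
  diagonal of \<open>X\<close>, so no extension of \<open>\<phi>\<close> to \<open>X\<close> is needed.\<close>

lemma continuous_entourage:
  fixes \<phi> :: "'x \<Rightarrow> 'b::real_normed_vector"
  assumes \<phi>: "continuous_map T euclidean \<phi>" and e: "e > 0"
  shows "topspace X \<times> topspace X - {(y, z) \<in> K \<times> K. e \<le> dist (\<phi> y) (\<phi> z)} \<in> entourages X"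
proof -
  let ?C = "{(y, z) \<in> K \<times> K. e \<le> dist (\<phi> y) (\<phi> z)}"
  have "continuous_map (prod_topology T T) euclideanreal (\<lambda>p. norm (\<phi> (fst p) - \<phi> (snd p)))"
    using continuous_map_compose[OF continuous_map_fst \<phi>, of T] continuous_map_compose[OF continuous_map_snd \<phi>, of T]
    by (intro continuous_map_norm continuous_map_diff) (simp_all add: o_def)
  then have "closedin (prod_topology T T) {p \<in> topspace (prod_topology T T). norm (\<phi> (fst p) - \<phi> (snd p)) \<in> {e..}}"
    by (rule closedin_continuous_map_preimage) simp
  moreover have "{p \<in> topspace (prod_topology T T). norm (\<phi> (fst p) - \<phi> (snd p)) \<in> {e..}} = ?C"
    by (auto simp: dist_norm)
  moreover have "prod_topology T T = subtopology (prod_topology X X) (K \<times> K)"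
    by (simp add: subtopology_Times)
  ultimately have "closedin (subtopology (prod_topology X X) (K \<times> K)) ?C"
    by (simp only:)
  moreover have "closedin (prod_topology X X) (K \<times> K)"
    by (simp add: closedin_prod_Times_iff)
  ultimately have C: "closedin (prod_topology X X) ?C"
    by (rule closedin_trans_full)
  let ?U = "topspace X \<times> topspace X - ?C"
  have "openin (prod_topology X X) (topspace (prod_topology X X) - ?C)"
    by (rule openin_diff[OF openin_topspace C])
  then have "openin (prod_topology X X) ?U"
    by (simp only: topspace_prod_topology)
  moreover have "Id_on (topspace X) \<subseteq> ?U"
    using e by (auto elim!: Id_onE)
  ultimately show ?thesis
    unfolding entourages_def by (intro CollectI conjI exI[of _ ?U] Diff_subset order_refl)
qed

text \<open>Stability gives every y a neighbourhood on which z |-> phi(hz) stays within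
  \<open>e/2\<close> of its value at y, uniformly in h. Finitely many of them cover the compact
  closure, and g is coloured by one that contains g x. As (hg)x = h(gx), equal colours keep the
  translates within \<open>e\<close>.\<close>

lemma lyapunov_finite_nets:
  fixes \<phi> :: "'x \<Rightarrow> 'b::real_normed_vector"
  assumes stable: "lyapunov_stable G X act" and \<phi>: "continuous_map T euclidean \<phi>"
  shows "finite_nets G (\<lambda>g. \<phi> (act g x))"
proof (rule finite_netsI)
  fix e :: real assume e: "e > 0"
  let ?U = "topspace X \<times> topspace X - {(y, z) \<in> K \<times> K. e / 2 \<le> dist (\<phi> y) (\<phi> z)}"
  have U: "?U \<in> entourages X"
    using e by (intro continuous_entourage[OF \<phi>]) simp
  have "\<exists>N. openin X N \<and> y \<in> N \<and> (\<forall>z\<in>N. \<forall>g\<in>carrier G. (act g y, act g z) \<in> ?U)" if y: "y \<in> topspace X" for y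
  proof -
    obtain V where V: "V \<in> entourages X" "\<forall>z. (y, z) \<in> V \<longrightarrow> (\<forall>g\<in>carrier G. (act g y, act g z) \<in> ?U)"
      using stable U y unfolding lyapunov_stable_def by meson
    obtain W where W: "openin (prod_topology X X) W" "Id_on (topspace X) \<subseteq> W" "W \<subseteq> V"
      using V(1) unfolding entourages_def by blast
    \<comment> \<open>The slice at \<open>y\<close> of an open set containing the diagonal is an
      open neighbourhood of \<open>y\<close>.\<close>
    have "continuous_map X (prod_topology X X) (\<lambda>z. (y, z))"
      using y by (simp add: continuous_map_pairwise o_def)
    then have "openin X {z \<in> topspace X. (y, z) \<in> W}"
      using W(1) by (rule openin_continuous_map_preimage)
    moreover have "y \<in> {z \<in> topspace X. (y, z) \<in> W}"
      using y W(2) by auto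
    ultimately show ?thesis
      using V(2) W(3) by (intro exI[of _ "{z \<in> topspace X. (y, z) \<in> W}"]) blast
  qed
  then have "\<forall>y\<in>topspace X. \<exists>N. openin X N \<and> y \<in> N \<and> (\<forall>z\<in>N. \<forall>g\<in>carrier G. (act g y, act g z) \<in> ?U)"
    by blast
  from bchoice[OF this] obtain N where N: "\<forall>y\<in>topspace X. openin X (N y) \<and> y \<in> N y \<and>
      (\<forall>z\<in>N y. \<forall>g\<in>carrier G. (act g y, act g z) \<in> ?U)" ..
  have "\<exists>\<F>. finite \<F> \<and> \<F> \<subseteq> N ` K \<and> K \<subseteq> \<Union>\<F>"
    using N K_subset by (intro compactinD[OF compactin_K]) auto
  then obtain F where F: "finite F" "F \<subseteq> K" "K \<subseteq> \<Union>(N ` F)"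
    by (metis finite_subset_image)
  have "\<forall>g\<in>carrier G. \<exists>y. y \<in> F \<and> act g x \<in> N y"
    using F(3) act_K[OF _ x_in_K] by blast
  from bchoice[OF this] obtain c where c: "\<forall>g\<in>carrier G. c g \<in> F \<and> act g x \<in> N (c g)" ..
  have near: "dist (\<phi> (act h (c g))) (\<phi> (act (h \<otimes> g) x)) \<le> e / 2" if gh: "g \<in> carrier G" "h \<in> carrier G" for g h
  proof -
    have cg: "c g \<in> K" "act g x \<in> N (c g)"
      using c gh(1) F(2) by blast+
    then have "(act h (c g), act h (act g x)) \<in> ?U"
      using N gh(2) K_subset by blast
    moreover have "act h (c g) \<in> K" "act h (act g x) \<in> K"
      using gh cg x_in_K act_K by blast+
    ultimately show ?thesis
      using gh x by (auto simp: act_mult)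
  qed
  show "\<exists>s. net_map G (\<lambda>g. \<phi> (act g x)) e s"
  proof (rule ex_net_map[where c = c])
    show "finite (c ` carrier G)"
      by (rule finite_subset[OF _ F(1)]) (use c in blast)
    fix g g' h assume g: "g \<in> carrier G" "g' \<in> carrier G" "c g = c g'" "h \<in> carrier G"
    show "dist (\<phi> (act (h \<otimes> g) x)) (\<phi> (act (h \<otimes> g') x)) \<le> e"
      using near[OF g(1,4)] near[OF g(2,4)]
        dist_triangle3[of "\<phi> (act (h \<otimes> g) x)" "\<phi> (act (h \<otimes> g') x)" "\<phi> (act h (c g))"]
      unfolding g(3) by linarith
  qed
qed

section \<open>Lyapunov stable actions: the invariant measure and the mean formula\<close>

context
  assumes stable: "lyapunov_stable G X act"
begin

text \<open>The positive functional to be represented; real-valued because the Riesz construction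
  is.\<close>

definition orbit_mean :: "('x \<Rightarrow> real) \<Rightarrow> real"
  where "orbit_mean \<phi> = (THE c. has_mean G (\<lambda>g. \<phi> (act g x)) c)"

lemma orbit_mean_eq: "has_mean G (\<lambda>g. \<phi> (act g x)) c \<Longrightarrow> orbit_mean \<phi> = c"
  unfolding orbit_mean_def by (rule the_has_mean)

lemma has_mean_orbit_mean:
  assumes "continuous_map T euclideanreal \<phi>"
  shows "has_mean G (\<lambda>g. \<phi> (act g x)) (orbit_mean \<phi>)"
proof -
  obtain c where "has_mean G (\<lambda>g. \<phi> (act g x)) c"
    using has_mean_exists_real[OF lyapunov_finite_nets[OF stable assms]] by blast
  then show ?thesis
    using orbit_mean_eq by simp
qed

lemma compact_mean_orbit_mean: "compact_mean T orbit_mean"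
proof
  show "compact_space T" "Hausdorff_space T"
    by (rule compact_T Hausdorff_T)+
  show "orbit_mean (\<lambda>_. 1) = 1"
    by (rule orbit_mean_eq[OF has_mean_const])
next
  fix f g :: "'x \<Rightarrow> real" assume "continuous_map T euclideanreal f" "continuous_map T euclideanreal g"
  then show "orbit_mean (\<lambda>y. f y + g y) = orbit_mean f + orbit_mean g"
    by (intro orbit_mean_eq has_mean_add has_mean_orbit_mean)
next
  fix f :: "'x \<Rightarrow> real" and c assume "continuous_map T euclideanreal f"
  then show "orbit_mean (\<lambda>y. c * f y) = c * orbit_mean f"
    by (intro orbit_mean_eq has_mean_linear[OF bounded_linear_mult_right] has_mean_orbit_mean)
next
  fix f :: "'x \<Rightarrow> real" assume "continuous_map T euclideanreal f" "\<And>y. y \<in> topspace T \<Longrightarrow> 0 \<le> f y"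
  then show "0 \<le> orbit_mean f"
    using act_K[OF _ x_in_K] by (intro has_mean_nonneg[OF has_mean_orbit_mean]) auto
qed

text \<open>Moving the argument by g is a left translation of the orbit function, under which
  two-sided averages keep their value.\<close>

lemma orbit_mean_act:
  assumes g: "g \<in> carrier G" and f: "continuous_map T euclideanreal f"
  shows "orbit_mean (\<lambda>y. f (act g y)) = orbit_mean f"
proof (rule orbit_mean_eq)
  show "has_mean G (\<lambda>h. f (act g (act h x))) (orbit_mean f)"
    by (rule has_mean_cong[OF has_mean_translate[OF has_mean_orbit_mean[OF f] g one_closed]])
      (use g x in \<open>simp add: act_mult\<close>)
qed

lemma invariant_regular_prob_exists: "\<exists>\<mu>. invariant_regular_prob G act T \<mu>"
proof -
  interpret L: compact_mean T orbit_mean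
    by (rule compact_mean_orbit_mean)
  let ?\<mu> = L.riesz_measure
  note reg = L.regular_riesz
  have le: "emeasure ?\<mu> A \<le> emeasure ?\<mu> (act g ` A)" if g: "g \<in> carrier G" and A: "A \<in> sets ?\<mu>" for g A
  proof (rule regular_borel_le_image[OF compact_T Hausdorff_T reg reg continuous_act_T[OF g] _ A act_image_sets[OF reg g A]])
    fix f assume f: "continuous_map T euclideanreal f"
    show "(\<integral>y. f (act g y) \<partial>?\<mu>) = (\<integral>y. f y \<partial>?\<mu>)"
      using L.L_eq_integral[OF f] L.L_eq_integral[OF continuous_comp_act[OF g f]] orbit_mean_act[OF g f] by simp
  qed
  have "emeasure ?\<mu> (act g ` A) = emeasure ?\<mu> A" if g: "g \<in> carrier G" and A: "A \<in> sets ?\<mu>" for g A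
  \<comment> \<open>One inequality for all group elements suffices: the reverse one is
    \<open>le\<close> for the inverse, applied to the image of \<open>A\<close>.\<close>
  proof (rule antisym[OF _ le[OF g A]])
    have "A \<subseteq> topspace X"
      using sets.sets_into_space[OF A] K_subset by auto
    then have "act (inv g) ` act g ` A = A"
      using act_inv_act[OF g] by (force simp: image_image)
    then show "emeasure ?\<mu> (act g ` A) \<le> emeasure ?\<mu> A"
      using le[OF inv_closed[OF g] act_image_sets[OF reg g A]] by simp
  qed
  then have "invariant_regular_prob G act T ?\<mu>"
    using reg L.emeasure_riesz_space by (simp add: invariant_regular_prob_def invariant_measure_def)
  then show ?thesis ..
qed

lemma invariant_regular_prob_unique:
  assumes \<mu>: "invariant_regular_prob G act T \<mu>" and \<nu>: "invariant_regular_prob G act T \<nu>"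
  shows "\<mu> = \<nu>"
proof -
  have reg: "regular_borel_measure T \<mu>" "regular_borel_measure T \<nu>"
    using \<mu> \<nu> by (simp_all add: invariant_regular_prob_def)
  have sets: "sets \<mu> = sets \<nu>"
    by (simp add: regular_borelD(2)[OF reg(1)] regular_borelD(2)[OF reg(2)])
  have int: "(\<integral>y. f y \<partial>\<mu>) = (\<integral>y. f y \<partial>\<nu>)" if f: "continuous_map T euclideanreal f" for f
    using integral_eq_mean[OF \<mu> f has_mean_orbit_mean[OF f]] integral_eq_mean[OF \<nu> f has_mean_orbit_mean[OF f]]
    by simp
  \<comment> \<open>With the identity as the transporting map, the comparison lemma that gave
    invariance now compares two measures on the same set.\<close>
  have id: "continuous_map T T (\<lambda>y. y)" by simp
  show ?thesis
  proof (rule measure_eqI[OF sets])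
    fix A assume A: "A \<in> sets \<mu>"
    have "emeasure \<mu> A \<le> emeasure \<nu> ((\<lambda>y. y) ` A)"
      using A sets int by (intro regular_borel_le_image[OF compact_T Hausdorff_T reg id]) simp_all
    moreover have "emeasure \<nu> A \<le> emeasure \<mu> ((\<lambda>y. y) ` A)"
      using A sets int by (intro regular_borel_le_image[OF compact_T Hausdorff_T reg(2,1) id]) simp_all
    ultimately show "emeasure \<mu> A = emeasure \<nu> A"
      by simp
  qed
qed

lemma ap_mean_eq_integral:
  fixes \<phi> :: "'x \<Rightarrow> complex"
  assumes \<mu>: "invariant_regular_prob G act T \<mu>" and \<phi>: "continuous_map X euclidean \<phi>"
  shows "ap_mean G (orbit_fun G act \<phi> x) = (LINT y|\<mu>. restrict \<phi> K y)"
proof -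
  have \<phi>T: "continuous_map T euclidean \<phi>"
    by (rule continuous_map_from_subtopology[OF \<phi>])
  note nets = lyapunov_finite_nets[OF stable \<phi>T]
  obtain c where c: "has_mean G (\<lambda>g. \<phi> (act g x)) c"
    using has_mean_exists[OF nets] by blast
  \<comment> \<open>\<open>restrict\<close> alters the function off \<open>K\<close> only, hence
    nowhere on the space of \<open>\<mu>\<close>.\<close>
  have "space \<mu> = K"
    using \<mu> regular_borelD(1)[of T \<mu>] by (simp add: invariant_regular_prob_def)
  then have "(LINT y|\<mu>. restrict \<phi> K y) = (LINT y|\<mu>. \<phi> y)"
    by (intro Bochner_Integration.integral_cong) simp_all
  then show ?thesis
    using ap_mean_orbit_fun[OF nets c] integral_eq_mean[OF \<mu> \<phi>T c] by simp
qed

end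

end

text \<open>The mean formula is claimed at every point of the orbit while the locale fixes one; this
  lets each point take its place without changing the orbit or its closure.\<close>

lemma homeo_orbit_change_point:
  assumes "homeo_orbit G X act x" "y \<in> orbit G act x"
  shows "homeo_orbit G X act y" "orbit G act y = orbit G act x"
proof -
  interpret homeo_orbit G X act x by fact
  show y: "homeo_orbit G X act y"
    using assms(2) orbit_subset action by unfold_locales auto
  interpret y: homeo_orbit G X act y by fact
  obtain b where b: "b \<in> carrier G" "y = act b x"
    using assms(2) by (auto simp: orbit_eq)
  then have "x = act (inv\<^bsub>G\<^esub> b) y"
    using act_inv_act x by simp
  then have "x \<in> orbit G act y"
    using b(1) by (auto simp: y.orbit_eq)
  show "orbit G act y = orbit G act x"
  proof
    show "orbit G act y \<subseteq> orbit G act x"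
      using act_orbit assms(2) by (auto simp: y.orbit_eq)
    show "orbit G act x \<subseteq> orbit G act y"
      using y.act_orbit \<open>x \<in> orbit G act y\<close> by (auto simp: orbit_eq)
  qed
qed

theorem theorem2p9:
  fixes \<Gamma> :: "('g, 'm) monoid_scheme" and X :: "'x topology" and act :: "'g \<Rightarrow> 'x \<Rightarrow> 'x"
  assumes "compact_space X" and "Hausdorff_space X"
    and "homeo_action \<Gamma> X act"
  shows "(lyapunov_stable \<Gamma> X act \<longrightarrow>
      (\<forall>\<gamma>\<in>orbits \<Gamma> (topspace X) act.
        (\<exists>!\<mu>. invariant_regular_prob \<Gamma> act (subtopology X (X closure_of \<gamma>)) \<mu>) \<and>
        (\<forall>\<mu>. invariant_regular_prob \<Gamma> act (subtopology X (X closure_of \<gamma>)) \<mu> \<longrightarrow>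
          (\<forall>\<phi> :: 'x \<Rightarrow> complex. continuous_map X euclidean \<phi> \<longrightarrow>
            (\<forall>x\<in>\<gamma>. ap_mean \<Gamma> (orbit_fun \<Gamma> act \<phi> x) =
              (LINT y|\<mu>. restrict \<phi> (X closure_of \<gamma>) y))))))
    \<and> (\<forall>\<gamma>\<in>orbits \<Gamma> (topspace X) act. finite \<gamma> \<longrightarrow>
      (\<forall>\<phi> :: 'x \<Rightarrow> complex. continuous_map X euclidean \<phi> \<longrightarrow>
        (\<forall>x\<in>\<gamma>. ap_mean \<Gamma> (orbit_fun \<Gamma> act \<phi> x) = (\<Sum>y\<in>\<gamma>. \<phi> y) / of_nat (card \<gamma>))))"
proof -
  have point: "compact_orbit \<Gamma> X act y \<and> orbit \<Gamma> act y = \<gamma>"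
    if \<gamma>: "\<gamma> \<in> orbits \<Gamma> (topspace X) act" and y: "y \<in> \<gamma>" for \<gamma> y
  proof -
    obtain x where x: "x \<in> topspace X" "\<gamma> = orbit \<Gamma> act x"
      using \<gamma> unfolding orbits_def by blast
    have "homeo_orbit \<Gamma> X act x"
      using assms(3) x(1) by unfold_locales
    from homeo_orbit_change_point[OF this y[unfolded x(2)]] show ?thesis
      using assms(1,2) x(2) by (simp add: compact_orbit_def compact_orbit_axioms_def)
  qed
  \<comment> \<open>Existence and uniqueness of the measure mention no point of the orbit, so a base
    point has to be supplied.\<close>
  have nonempty: "\<exists>y. y \<in> \<gamma>" if \<gamma>: "\<gamma> \<in> orbits \<Gamma> (topspace X) act" for \<gamma>
  proof -
    obtain x where x: "x \<in> topspace X" "\<gamma> = orbit \<Gamma> act x"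
      using \<gamma> unfolding orbits_def by blast
    have "group_action \<Gamma> (topspace X) act"
      using assms(3) by (simp add: homeo_action_def)
    then have "x \<in> \<gamma>"
      unfolding x(2) using x(1) by (rule group_action.orbit_refl)
    then show ?thesis ..
  qed
  show ?thesis
  proof (intro conjI impI ballI allI)
    fix \<gamma> assume stable: "lyapunov_stable \<Gamma> X act" and \<gamma>: "\<gamma> \<in> orbits \<Gamma> (topspace X) act"
    obtain y where "y \<in> \<gamma>"
      using nonempty[OF \<gamma>] by blast
    then have y: "compact_orbit \<Gamma> X act y" "orbit \<Gamma> act y = \<gamma>"
      using point[OF \<gamma>] by blast+
    show "\<exists>!\<mu>. invariant_regular_prob \<Gamma> act (subtopology X (X closure_of \<gamma>)) \<mu>"
      using compact_orbit.invariant_regular_prob_exists[OF y(1) stable]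
        compact_orbit.invariant_regular_prob_unique[OF y(1) stable]
      unfolding y(2) by blast
  next
    fix \<gamma> \<mu> x and \<phi> :: "'x \<Rightarrow> complex"
    assume stable: "lyapunov_stable \<Gamma> X act" and \<gamma>: "\<gamma> \<in> orbits \<Gamma> (topspace X) act"
      and \<mu>: "invariant_regular_prob \<Gamma> act (subtopology X (X closure_of \<gamma>)) \<mu>"
      and \<phi>: "continuous_map X euclidean \<phi>" and x: "x \<in> \<gamma>"
    have "compact_orbit \<Gamma> X act x" and eq: "orbit \<Gamma> act x = \<gamma>"
      using point[OF \<gamma> x] by blast+
    then show "ap_mean \<Gamma> (orbit_fun \<Gamma> act \<phi> x) = (LINT y|\<mu>. restrict \<phi> (X closure_of \<gamma>) y)"
      using compact_orbit.ap_mean_eq_integral[of \<Gamma> X act x \<mu> \<phi>] stable \<mu> \<phi> by simp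
  next
    fix \<gamma> x and \<phi> :: "'x \<Rightarrow> complex"
    assume \<gamma>: "\<gamma> \<in> orbits \<Gamma> (topspace X) act" and fin: "finite \<gamma>" and x: "x \<in> \<gamma>"
    have "compact_orbit \<Gamma> X act x" and eq: "orbit \<Gamma> act x = \<gamma>"
      using point[OF \<gamma> x] by blast+
    then show "ap_mean \<Gamma> (orbit_fun \<Gamma> act \<phi> x) = (\<Sum>y\<in>\<gamma>. \<phi> y) / of_nat (card \<gamma>)"
      using homeo_orbit.ap_mean_finite_orbit[of \<Gamma> X act x \<phi>] fin by (simp add: compact_orbit_def)
  qed
qed

end
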